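(* Let $\alpha\in\mathbb{Q}$. (1) If $|\alpha|<2$, then there are only finitely many totally real algebraic numbers $c$ such that $\alpha$ is $f_c$-preperiodic. Furthermore, the set of such $c$ is always non-empty. (2) If $|\alpha|\ge 2$, then there are infinitely many totally real algebraic numbers $c$ such that $\alpha$ is $f_c$-preperiodic.
   Context: For $c\in\mathbb{C}$ let $f_c(x)=x^2+c$, and let $f_c^n$ denote the $n$-fold composition of $f_c$ with itself ($f_c^0$ is the identity). A point $\alpha$ is $f_c$-preperiodic if $f_c^n(\alpha)=f_c^m(\alpha)$ for some integers $0\le m<n$. An algebraic number $c\in\overline{\mathbb{Q}}$ is totally real if all complex roots of its minimal polynomial over $\mathbb{Q}$ are real. *)

theory Defs
  imports "HOL-Computational_Algebra.Computational_Algebra"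
begin

definition quad_map :: "complex \<Rightarrow> complex \<Rightarrow> complex" where
  "quad_map c x = x ^ 2 + c"

definition preperiodic :: "('a \<Rightarrow> 'a) \<Rightarrow> 'a \<Rightarrow> bool" where
  "preperiodic f x \<longleftrightarrow> (\<exists>m n :: nat. m < n \<and> (f ^^ n) x = (f ^^ m) x)"

definition is_min_poly :: "complex \<Rightarrow> rat poly \<Rightarrow> bool" where
  "is_min_poly c p \<longleftrightarrow>
     lead_coeff p = 1 \<and> irreducible p \<and> poly (map_poly of_rat p) c = 0"

text \<open>Only meaningful for algebraic arguments, where \<open>is_min_poly\<close> has exactly one
  solution (\<open>min_poly_ex1\<close> below).\<close>

definition min_poly :: "complex \<Rightarrow> rat poly" where
  "min_poly c = (THE p. is_min_poly c p)"

definition totally_real :: "complex \<Rightarrow> bool" where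
  "totally_real c \<longleftrightarrow>
     algebraic c \<and> (\<forall>z::complex. poly (map_poly of_rat (min_poly c)) z = 0 \<longrightarrow> z \<in> \<real>)"

lemma of_rat_poly_hom:
  fixes p q :: "rat poly" and c :: complex
  shows "poly (map_poly of_rat (p * q)) c = poly (map_poly of_rat p) c * poly (map_poly of_rat q) c"
    and "poly (map_poly of_rat (p + q)) c = poly (map_poly of_rat p) c + poly (map_poly of_rat q) c"
proof -
  show add: "poly (map_poly of_rat (p + q)) c = poly (map_poly of_rat p) c + poly (map_poly of_rat q) c"
    for p q :: "rat poly"
  proof -
    have "map_poly of_rat (p + q) = (map_poly of_rat p + map_poly of_rat q :: complex poly)"
      by (rule poly_eqI) (simp add: coeff_map_poly of_rat_add)
    then show ?thesis by simp
  qed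
  have smult: "poly (map_poly of_rat (smult a r)) c = of_rat a * poly (map_poly of_rat r) c"
    for a and r :: "rat poly"
  proof -
    have "map_poly of_rat (smult a r) = (smult (of_rat a) (map_poly of_rat r) :: complex poly)"
      by (rule poly_eqI) (simp add: coeff_map_poly of_rat_mult)
    then show ?thesis by simp
  qed
  show "poly (map_poly of_rat (p * q)) c = poly (map_poly of_rat p) c * poly (map_poly of_rat q) c"
    by (induction p) (simp_all add: add smult map_poly_pCons algebra_simps)
qed

lemma min_poly_ex1:
  assumes "algebraic c"
  shows "\<exists>!p. is_min_poly c p"
proof -
  let ?e = "\<lambda>p :: rat poly. poly (map_poly of_rat p) c"
  define S where "S = {p. p \<noteq> 0 \<and> ?e p = 0}"
  obtain p0 where p0: "\<And>i. coeff p0 i \<in> \<int>" "p0 \<noteq> 0" "poly p0 c = 0"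
    using assms by (auto simp: algebraic_def)
  define g :: "complex \<Rightarrow> rat" where "g x = (SOME r. of_rat r = x)" for x
  have g: "of_rat (g x) = x" if "x \<in> \<int>" for x
  proof -
    obtain k where "x = of_int k" using \<open>x \<in> \<int>\<close> by (auto elim: Ints_cases)
    then have "of_rat (of_int k) = x" by simp
    then show ?thesis unfolding g_def by (rule someI)
  qed
  have g0: "g 0 = 0" using g[of 0] by simp
  have "map_poly of_rat (map_poly g p0) = p0"
    by (rule poly_eqI) (simp add: coeff_map_poly g0 g p0)
  then have "map_poly g p0 \<in> S" using p0 by (auto simp: S_def)
  then obtain p where p: "p \<in> S" and least: "\<And>q. q \<in> S \<Longrightarrow> degree p \<le> degree q"
    using ex_has_least_nat[of "\<lambda>q. q \<in> S" _ degree] by blast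
  define m where "m = smult (inverse (lead_coeff p)) p"
  have degm: "degree m = degree p" and lcm: "lead_coeff m = 1" and m0: "m \<noteq> 0"
    using p by (auto simp: m_def S_def)
  have em: "?e m = 0"
  proof -
    have "m = [:inverse (lead_coeff p):] * p" by (simp add: m_def)
    then show ?thesis using p by (simp only: of_rat_poly_hom) (simp add: S_def)
  qed
  have dvd: "m dvd q" if "?e q = 0" for q
  proof -
    have "?e q = ?e (q div m * m + q mod m)" by simp
    also have "\<dots> = ?e (q mod m)" by (simp only: of_rat_poly_hom em) simp
    finally have "?e (q mod m) = 0" using that by simp
    then have "q mod m = 0 \<or> degree m \<le> degree (q mod m)"
      using least[of "q mod m"] degm by (auto simp: S_def)
    then have "q mod m = 0" using degree_mod_less[OF m0, of q] by auto
    then show ?thesis by (simp add: mod_eq_0_iff_dvd)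
  qed
  have nounit: "\<not> is_unit r" if e: "?e r = 0" for r
  proof
    assume "is_unit r"
    then obtain s where "1 = r * s" by (auto elim: dvdE)
    then have "?e 1 = ?e r * ?e s" by (metis of_rat_poly_hom(1))
    then show False using e by simp
  qed
  have irr: "irreducible m"
  proof (rule irreducibleI)
    show "m \<noteq> 0" by (rule m0)
    show "\<not> is_unit m" using nounit em .
    fix a b assume ab: "m = a * b"
    then have nz: "a \<noteq> 0" "b \<noteq> 0" using m0 by auto
    have deg: "degree m = degree a + degree b" using ab nz by (simp add: degree_mult_eq)
    have "?e a * ?e b = 0" using em unfolding ab of_rat_poly_hom .
    then consider "a \<in> S" | "b \<in> S" using nz by (auto simp: S_def)
    then show "is_unit a \<or> is_unit b"
    proof cases
      case 1
      then have "degree b = 0" using least[of a] deg degm by simp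
      then show ?thesis using nz by (simp add: is_unit_iff_degree)
    next
      case 2
      then have "degree a = 0" using least[of b] deg degm by simp
      then show ?thesis using nz by (simp add: is_unit_iff_degree)
    qed
  qed
  show ?thesis
  proof (rule ex1I[of _ m])
    show "is_min_poly c m" using irr em lcm by (simp add: is_min_poly_def)
    fix q assume q: "is_min_poly c q"
    then obtain r where r: "q = m * r" using dvd[of q] by (auto simp: is_min_poly_def elim: dvdE)
    have "is_unit r"
      using q r nounit[OF em] by (auto simp: is_min_poly_def irreducible_def)
    then obtain k where k: "r = [:k:]" by (auto simp: is_unit_poly_iff)
    have "lead_coeff q = lead_coeff m * lead_coeff r" by (simp add: r lead_coeff_mult)
    then have "k = 1" using q lcm k by (simp add: is_min_poly_def)
    then show "q = m" using r k by simp
  qed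
qed

lemma is_min_poly_min_poly: "algebraic c \<Longrightarrow> is_min_poly c (min_poly c)"
  unfolding min_poly_def by (rule theI', rule min_poly_ex1)

end

theory Submission
  imports Defs "HOL-Computational_Algebra.Field_as_Ring" "HOL-Library.FuncSet"
begin

text \<open>
  Let \<open>P\<^sub>n(c) = f\<^sub>c\<^sup>n(\<alpha>)\<close>, a monic polynomial in \<open>c\<close> of degree \<open>2\<^sup>n\<^sup>-\<^sup>1\<close>.

  If \<open>a = \<bar>\<alpha>\<bar> \<ge> 2\<close>, then \<open>P\<^sub>2(t) \<ge> -t\<close>, \<open>P\<^sub>2(t) \<le> t\<close>, \<open>P\<^sub>2(t) \<ge> -t\<close> at \<open>t = -2a\<^sup>2, -a\<^sup>2, -a\<^sup>2/2\<close>;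
  the recursion doubles the number of such alternations, so that all roots of \<open>P\<^sub>n - a\<close> are real.

  If \<open>\<bar>\<alpha>\<bar> < 2\<close>, the set \<open>E\<close> of real parameters with preperiodic \<open>\<alpha>\<close> has capacity below 1, made
  explicit as follows. On \<open>E\<close> all \<open>P\<^sub>n\<close> are bounded by 4. Just to the right of the endpoint
  \<open>b = a - a\<^sup>2\<close>, \<open>a = max \<bar>\<alpha>\<bar> (1/2)\<close>, the orbit of \<open>\<alpha>\<close> leaves the fixed point with multiplier
  \<open>2a < 4\<close>, whereas Chebyshev polynomials of an interval ending in \<open>b\<close> grow with multiplier 4; so
  \<open>P\<^sub>n\<close> is negligible there against a Chebyshev polynomial of half its degree, and a harmless
  perturbation of \<open>P\<^sub>n\<close> vanishes at prescribed points \<open>x > b\<close>. Moving these zeros to \<open>b\<close> shrinks the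
  sup norm on \<open>E\<close> by a constant factor each, which gives monic real polynomials that are arbitrarily
  small on \<open>E\<close>. By the pigeonhole principle there is then a nonzero polynomial \<open>F\<close> in the ring
  generated by the polynomials \<open>b P\<^sub>n\<close> (\<open>b\<close> now the denominator of \<open>\<alpha>\<close>) with \<open>\<bar>F\<bar> < 1\<close> on \<open>E\<close>. For a
  totally real \<open>c\<close> with preperiodic \<open>\<alpha>\<close>, the number \<open>F(c)\<close> is an algebraic integer all of whose
  conjugates have absolute value below 1, so \<open>F(c) = 0\<close>.
\<close>

section \<open>Rational polynomials, conjugates and orbits\<close>

abbreviation rpoly :: "rat poly \<Rightarrow> 'a::field_char_0 poly" where
  "rpoly \<equiv> map_poly of_rat"

lemma rpoly_hom:
  "rpoly (p + q) = (rpoly p + rpoly q :: 'a::field_char_0 poly)"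
  "rpoly (p - q) = (rpoly p - rpoly q :: 'a::field_char_0 poly)"
  "rpoly (smult a p) = (smult (of_rat a) (rpoly p) :: 'a::field_char_0 poly)"
  "rpoly (p * q) = (rpoly p * rpoly q :: 'a::field_char_0 poly)"
  "rpoly 1 = (1 :: 'a::field_char_0 poly)"
proof -
  show add: "rpoly (p + q) = (rpoly p + rpoly q :: 'a poly)" for p q
    by (rule poly_eqI) (simp add: coeff_map_poly of_rat_add)
  show "rpoly (p - q) = (rpoly p - rpoly q :: 'a poly)"
    by (rule poly_eqI) (simp add: coeff_map_poly of_rat_diff)
  show smult: "rpoly (smult a p) = (smult (of_rat a) (rpoly p) :: 'a poly)" for a p
    by (rule poly_eqI) (simp add: coeff_map_poly of_rat_mult)
  show "rpoly (p * q) = (rpoly p * rpoly q :: 'a poly)"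
    by (induction p) (simp_all add: add smult map_poly_pCons)
  show "rpoly 1 = (1 :: 'a poly)" by simp
qed

lemma rpoly_power: "rpoly (p ^ n) = (rpoly p ^ n :: 'a::field_char_0 poly)"
  by (induction n) (simp_all add: rpoly_hom)

lemma rpoly_eq_0_iff: "(rpoly p :: 'a::field_char_0 poly) = 0 \<longleftrightarrow> p = 0"
  by (simp add: poly_eq_iff coeff_map_poly)

lemma of_rat_eq_of_real: "of_rat a = (of_real (of_rat a) :: complex)"
  by (cases a) (simp add: of_rat_rat)

lemma poly_rpoly_of_real:
  "poly (rpoly p) (of_real t :: complex) = of_real (poly (rpoly p) t)"
  by (induction p) (simp_all add: map_poly_pCons of_rat_eq_of_real)

lemma rpoly_const: "rpoly [:k:] = [:of_rat k:]"
  by (simp add: map_poly_pCons)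

section \<open>Iterates as polynomials in the parameter\<close>

primrec orb :: "'a::comm_ring_1 \<Rightarrow> nat \<Rightarrow> 'a poly" where
  "orb x 0 = [:x:]"
| "orb x (Suc n) = orb x n ^ 2 + [:0, 1:]"

lemma poly_orb: "poly (orb x n) c = ((\<lambda>y. y ^ 2 + c) ^^ n) x"
  by (induction n) simp_all

lemma poly_orb_Suc: "poly (orb x (Suc n)) c = (poly (orb x n) c)\<^sup>2 + c"
  by simp

lemma rpoly_orb: "rpoly (orb x n) = (orb (of_rat x) n :: 'a::field_char_0 poly)"
  by (induction n) (simp_all add: rpoly_hom rpoly_power map_poly_pCons)

lemma preperiodic_iff_orb:
  "preperiodic (quad_map c) x \<longleftrightarrow> (\<exists>m n. m < n \<and> poly (orb x n) c = poly (orb x m) c)"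
proof -
  have "quad_map c = (\<lambda>y. y ^ 2 + c)" by (simp add: fun_eq_iff quad_map_def)
  then show ?thesis by (simp add: preperiodic_def poly_orb)
qed

lemma orb_monic:
  fixes x :: "'a::idom"
  shows "degree (orb x (Suc n)) = 2 ^ n" "lead_coeff (orb x (Suc n)) = 1"
proof -
  have "degree (orb x (Suc n)) = 2 ^ n \<and> lead_coeff (orb x (Suc n)) = 1"
  proof (induction n)
    case 0
    have "orb x (Suc 0) = [:x\<^sup>2, 1:]" by (simp add: power2_eq_square)
    then show ?case by simp
  next
    case (Suc n)
    define p where "p = orb x (Suc n)"
    have p: "degree p = 2 ^ n" "lead_coeff p = 1" using Suc by (auto simp: p_def)
    have d: "degree (p ^ 2) = 2 ^ Suc n" using p by (subst degree_power_eq) auto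
    have lt: "degree [:0, 1 :: 'a:] < degree (p ^ 2)"
      unfolding d using one_less_power[of "2::nat" "Suc n"] by simp
    have eq: "orb x (Suc (Suc n)) = [:0, 1:] + p ^ 2" by (simp add: p_def)
    have "degree (orb x (Suc (Suc n))) = 2 ^ Suc n"
      by (simp only: eq degree_add_eq_right[OF lt] d)
    moreover have "lead_coeff (orb x (Suc (Suc n))) = 1"
      using p by (simp only: eq lead_coeff_add_le[OF lt] lead_coeff_power power_one)
    ultimately show ?case by blast
  qed
  then show "degree (orb x (Suc n)) = 2 ^ n" "lead_coeff (orb x (Suc n)) = 1" by auto
qed

section \<open>Divisibility by the minimal polynomial, and separability\<close>

lemma algebraic_if_root:
  assumes "q \<noteq> 0" "poly (rpoly q) c = 0"
  shows "algebraic c"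
  using assms by (intro algebraicI'[of "rpoly q"]) (auto simp: coeff_map_poly rpoly_eq_0_iff)

lemma coprime_no_common_root:
  assumes "coprime p (q :: rat poly)" "poly (rpoly p) (c::complex) = 0" "poly (rpoly q) c = 0"
  shows False
proof -
  obtain r s where "r * p + s * q = 1"
    using bezout_coefficients_fst_snd[of p q] assms(1) by auto
  then have "rpoly (r * p + s * q) = (1 :: complex poly)" by (simp add: rpoly_hom)
  then have "poly (rpoly (r * p + s * q)) c = 1" by simp
  then show False using assms by (simp add: rpoly_hom)
qed

lemma min_poly_dvd:
  assumes "algebraic c" "poly (rpoly q) c = 0"
  shows "min_poly c dvd q"
proof (rule ccontr)
  assume "\<not> min_poly c dvd q"
  have "irreducible (min_poly c)" and c: "poly (rpoly (min_poly c)) c = 0"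
    using is_min_poly_min_poly[OF assms(1)] by (auto simp: is_min_poly_def)
  with \<open>\<not> min_poly c dvd q\<close> have "coprime (min_poly c) q"
    by (intro prime_elem_imp_coprime) (auto dest: irreducible_imp_prime_elem_gcd)
  then show False using coprime_no_common_root c assms(2) by blast
qed

lemma conjugate_root:
  assumes "algebraic c" "poly (rpoly q) c = 0" "poly (rpoly (min_poly c)) z = 0"
  shows "poly (rpoly q) z = 0"
proof -
  obtain r where "q = min_poly c * r" using min_poly_dvd[OF assms(1,2)] by (auto elim: dvdE)
  then show ?thesis using assms(3) by (simp add: rpoly_hom)
qed

lemma totally_real_if_all_roots_real:
  assumes "q \<noteq> 0" "poly (rpoly q) c = 0"
    and "\<And>z::complex. poly (rpoly q) z = 0 \<Longrightarrow> z \<in> \<real>"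
  shows "totally_real c"
  unfolding totally_real_def
  using algebraic_if_root[OF assms(1,2)] conjugate_root[OF _ assms(2)] assms(3) by blast

text \<open>Separability: in characteristic 0 an irreducible polynomial is coprime to its
  derivative, which is nonzero of smaller degree. The conjugates serve later as interpolation nodes,
  so there must be as many as the degree.\<close>

lemma card_conjugates:
  assumes "algebraic c"
  shows "card {z::complex. poly (rpoly (min_poly c)) z = 0} = degree (min_poly c)"
proof -
  define p where "p = min_poly c"
  have irr: "irreducible p" and lc: "lead_coeff p = 1" and c: "poly (rpoly p) c = 0"
    using is_min_poly_min_poly[OF assms] by (auto simp: is_min_poly_def p_def)
  have deg: "degree (rpoly p :: complex poly) = degree p" by (simp add: degree_map_poly)
  have "degree p \<noteq> 0"
  proof
    assume "degree p = 0"
    then obtain k where "p = [:k:]" by (auto elim: degree_eq_zeroE)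
    then show False using lc c by (simp add: rpoly_const)
  qed
  then have "pderiv p \<noteq> 0" by (simp add: pderiv_eq_0_iff)
  moreover have "degree (pderiv p) < degree p" using \<open>degree p \<noteq> 0\<close> by (simp add: degree_pderiv)
  ultimately have "\<not> p dvd pderiv p" by simp
  then have cop: "coprime p (pderiv p)"
    using irr by (intro prime_elem_imp_coprime) (auto dest: irreducible_imp_prime_elem_gcd)
  have pd: "rpoly (pderiv p) = (pderiv (rpoly p) :: complex poly)"
    by (rule poly_eqI) (simp add: coeff_map_poly coeff_pderiv of_rat_mult of_rat_add)
  have "rsquarefree (rpoly p :: complex poly)"
    unfolding rsquarefree_roots using coprime_no_common_root[OF cop] by (auto simp: pd)
  then have "smult (lead_coeff (rpoly p)) (\<Prod>z | poly (rpoly p) z = 0. [:-z, 1:]) = (rpoly p :: complex poly)"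
    by (rule complex_poly_decompose_rsquarefree)
  moreover have "lead_coeff (rpoly p :: complex poly) = 1"
    using deg lc by (simp add: coeff_map_poly)
  ultimately have "degree (\<Prod>z | poly (rpoly p) z = 0. [:-z, 1 :: complex:]) = degree p"
    using deg by (metis smult_1_left)
  moreover have "degree (\<Prod>z | poly (rpoly p) z = 0. [:-z, 1 :: complex:])
      = (\<Sum>z | poly (rpoly p) z = (0::complex). degree [:-z, 1:])"
    by (rule degree_prod_sum_eq) auto
  ultimately show ?thesis by (simp add: p_def)
qed

section \<open>Parameters for \<open>\<bar>\<alpha>\<bar> \<ge> 2\<close>\<close>

lemma orb_minus: "orb (- x) (Suc n) = orb x (Suc n)"
  by (induction n) (simp_all add: power2_eq_square)

lemma orb_abs: "orb \<bar>x :: rat\<bar> (Suc n) = orb x (Suc n)"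
  by (cases "x \<ge> 0") (simp_all add: orb_minus del: orb.simps)

text \<open>The bound \<open>- (a\<^sup>2 / 2)\<close> serves twice: it is at most -2, which the
  doubling step needs, and its absolute value is at least \<open>a\<close>, which later forces roots
  of \<open>P - a\<close> and not only of \<open>P\<close>.\<close>

lemma orb_alternating:
  fixes a :: real
  assumes "a \<ge> 2"
  shows "\<exists>t. (\<forall>i < 2 ^ Suc n. t i < t (Suc i)) \<and>
      (\<forall>i \<le> 2 ^ Suc n. t i \<le> - (a\<^sup>2 / 2) \<and>
        (even i \<longrightarrow> poly (orb a (Suc (Suc n))) (t i) \<ge> - t i) \<and>
        (odd i \<longrightarrow> poly (orb a (Suc (Suc n))) (t i) \<le> t i))"
proof (induction n)
  case 0
  have a2: "a\<^sup>2 \<ge> 4" using assms power_mono[of 2 a 2] by simp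
  have P: "poly (orb a (Suc (Suc 0))) c = (a\<^sup>2 + c)\<^sup>2 + c" for c
    by (simp add: power2_eq_square algebra_simps)
  define t where "t i = (if i = 0 then - 2 * a\<^sup>2 else if i = 1 then - a\<^sup>2 else - (a\<^sup>2 / 2))" for i :: nat
  have sq: "a\<^sup>2 * a\<^sup>2 \<ge> 4 * a\<^sup>2" using a2 by (intro mult_right_mono) auto
  have "- t i \<le> poly (orb a (Suc (Suc 0))) (t i)" if "i = 0 \<or> i = 2" for i
    using that a2 sq unfolding P t_def by (auto simp: power2_eq_square algebra_simps)
  moreover have "poly (orb a (Suc (Suc 0))) (t 1) \<le> t 1"
    unfolding P t_def by simp
  moreover have "t i < t (Suc i)" if "i < 2 ^ Suc 0" for i
  proof -
    from that have "i = 0 \<or> i = 1" by auto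
    then show ?thesis using a2 by (auto simp: t_def)
  qed
  moreover have "t i \<le> - (a\<^sup>2 / 2)" for i using a2 by (simp add: t_def)
  moreover have "even i \<longleftrightarrow> i = 0 \<or> i = 2" "odd i \<longleftrightarrow> i = 1" if "i \<le> 2 ^ Suc 0" for i :: nat
  proof -
    from that have "i = 0 \<or> i = 1 \<or> i = 2" by auto
    then show "even i \<longleftrightarrow> i = 0 \<or> i = 2" "odd i \<longleftrightarrow> i = 1" by auto
  qed
  ultimately show ?case by (intro exI[of _ t]) metis
next
  case (Suc n)
  define P where "P = orb a (Suc (Suc n))"
  define k where "k = (2::nat) ^ Suc n"
  obtain t where t: "\<And>i. i < k \<Longrightarrow> t i < t (Suc i)" "\<And>i. i \<le> k \<Longrightarrow> t i \<le> - (a\<^sup>2 / 2)"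
      "\<And>i. i \<le> k \<Longrightarrow> even i \<Longrightarrow> poly P (t i) \<ge> - t i"
      "\<And>i. i \<le> k \<Longrightarrow> odd i \<Longrightarrow> poly P (t i) \<le> t i"
    using Suc unfolding P_def k_def by blast
  have "a\<^sup>2 \<ge> 4" using assms power_mono[of 2 a 2] by simp
  then have t2: "t i \<le> -2" if "i \<le> k" for i using t(2)[OF that] by simp
  have "\<exists>z. t i < z \<and> z < t (Suc i) \<and> poly P z = 0" if i: "i < k" for i
  proof (cases "even i")
    case True
    then show ?thesis using t(1)[of i] t(3)[of i] t(4)[of "Suc i"] t2[of i] t2[of "Suc i"] i
      by (intro poly_IVT_neg) auto
  next
    case False
    then show ?thesis using t(1)[of i] t(4)[of i] t(3)[of "Suc i"] t2[of i] t2[of "Suc i"] i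
      by (intro poly_IVT_pos) auto
  qed
  then obtain z where z: "\<And>i. i < k \<Longrightarrow> t i < z i \<and> z i < t (Suc i) \<and> poly P (z i) = 0"
    by metis
  \<comment> \<open>Old points go to even places and the new zeros of \<open>P\<close> to odd
    places; at a zero \<open>z\<close> the next iterate has the value \<open>z\<close>
    itself.\<close>
  define s where "s i = (if even i then t (i div 2) else z (i div 2))" for i
  have Q: "poly (orb a (Suc (Suc (Suc n)))) c = (poly P c)\<^sup>2 + c" for c
    by (simp add: P_def)
  have k2: "2 ^ Suc (Suc n) = 2 * k" by (simp add: k_def)
  have even: "s i \<le> - (a\<^sup>2 / 2) \<and> - s i \<le> (poly P (s i))\<^sup>2 + s i" if "i \<le> 2 * k" "even i" for i
  proof -
    define u where "u = t (i div 2)"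
    have u: "u \<le> -2" "u \<le> - (a\<^sup>2 / 2)" "- u \<le> \<bar>poly P u\<bar>"
      using t(2,3,4)[of "i div 2"] t2[of "i div 2"] that unfolding u_def
      by (cases "even (i div 2)"; force)+
    \<comment> \<open>As \<open>u \<le> -2\<close>, one has \<open>u\<^sup>2 + u \<ge> - u\<close>,
      and \<open>(poly P u)\<^sup>2\<close> is at least \<open>u\<^sup>2\<close>.\<close>
    have "(- u)\<^sup>2 \<le> \<bar>poly P u\<bar>\<^sup>2" using u by (intro power_mono) auto
    moreover have "(-2 - u) * (- u) \<ge> 0" using u by (intro mult_nonneg_nonneg) auto
    ultimately have "- u \<le> (poly P u)\<^sup>2 + u"
      by (simp add: power2_eq_square algebra_simps)
    then show ?thesis using u that by (simp add: s_def u_def)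
  qed
  have odd: "s i \<le> - (a\<^sup>2 / 2) \<and> (poly P (s i))\<^sup>2 + s i \<le> s i" if "i \<le> 2 * k" "odd i" for i
  proof -
    have "i div 2 < k" using that by (auto elim: oddE)
    then show ?thesis using z[of "i div 2"] t(2)[of "Suc (i div 2)"] that by (simp add: s_def)
  qed
  have mono: "s i < s (Suc i)" if "i < 2 * k" for i
  proof (cases "even i")
    case True
    then show ?thesis using z[of "i div 2"] that by (auto simp: s_def)
  next
    case False
    then have "Suc i div 2 = Suc (i div 2)" "i div 2 < k" using that by (auto elim: oddE)
    then show ?thesis using False z[of "i div 2"] by (simp add: s_def)
  qed
  show ?case unfolding Q k2
    using mono even odd by (intro exI[of _ s]) blast
qed

lemma strictly_increasing_segment:
  fixes r :: "nat \<Rightarrow> 'a::order"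
  assumes "\<And>i. Suc i < k \<Longrightarrow> r i < r (Suc i)" "i < j" "j < k"
  shows "r i < r j"
  using assms(2,3)
proof (induction j)
  case (Suc j)
  then show ?case using assms(1)[of j] by (cases "i = j") (auto intro: less_trans)
qed simp

text \<open>Each of the \<open>2 ^ Suc n\<close> gaps of the alternation contains a root, and this
  number is the full degree of the polynomial.\<close>

lemma orb_eq_self_real_roots:
  fixes a :: real
  assumes "a \<ge> 2"
  shows "\<exists>R. finite R \<and> card R = 2 ^ Suc n \<and> (\<forall>r\<in>R. poly (orb a (Suc (Suc n))) r = a)"
proof -
  define P where "P = orb a (Suc (Suc n))"
  define k where "k = (2::nat) ^ Suc n"
  obtain t where t: "\<And>i. i < k \<Longrightarrow> t i < t (Suc i)" "\<And>i. i \<le> k \<Longrightarrow> t i \<le> - (a\<^sup>2 / 2)"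
      "\<And>i. i \<le> k \<Longrightarrow> even i \<Longrightarrow> poly P (t i) \<ge> - t i"
      "\<And>i. i \<le> k \<Longrightarrow> odd i \<Longrightarrow> poly P (t i) \<le> t i"
    using orb_alternating[OF assms, of n] unfolding P_def k_def by blast
  have "a * a \<ge> 2 * a" using assms by (intro mult_right_mono) auto
  then have a2: "a \<le> a\<^sup>2 / 2" by (simp add: power2_eq_square)
  define p where "p = P - [:a:]"
  have p: "poly p x = poly P x - a" for x by (simp add: p_def)
  \<comment> \<open>Half-open gaps: for \<open>a = 2\<close> the last point can be -2, where the
    polynomial can take the value 2 itself. Being disjoint, the gaps still give distinct
    roots.\<close>
  have "\<exists>r. t i < r \<and> r \<le> t (Suc i) \<and> poly p r = 0" if i: "i < k" for i
  proof (cases "even i")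
    case True
    have "- t i > a" using t(1)[OF i] t(2)[of "Suc i"] i a2 by simp
    moreover have "t (Suc i) < a" using t(2)[of "Suc i"] i a2 assms by simp
    ultimately have "\<exists>r. t i < r \<and> r < t (Suc i) \<and> poly p r = 0"
      using t(1)[of i] t(3)[of i] t(4)[of "Suc i"] i True
      by (intro poly_IVT_neg) (auto simp: p)
    then show ?thesis by force
  next
    case False
    show ?thesis
    proof (cases "poly p (t (Suc i)) = 0")
      case True
      then show ?thesis using t(1)[OF i] by auto
    next
      case False
      have "t i < a" using t(2)[of i] i a2 assms by simp
      moreover have "- t (Suc i) \<ge> a" using t(2)[of "Suc i"] i a2 assms by simp
      ultimately have "\<exists>r. t i < r \<and> r < t (Suc i) \<and> poly p r = 0"
        using t(1)[of i] t(4)[of i] t(3)[of "Suc i"] i \<open>odd i\<close> False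
        by (intro poly_IVT_pos) (auto simp: p)
      then show ?thesis by force
    qed
  qed
  then obtain r where r: "\<And>i. i < k \<Longrightarrow> t i < r i \<and> r i \<le> t (Suc i) \<and> poly p (r i) = 0"
    by metis
  have "r i < r (Suc i)" if "Suc i < k" for i
    using r[of i] r[of "Suc i"] that by force
  then have "r i < r j" if "i < j" "j < k" for i j
    using strictly_increasing_segment[of k r] that by blast
  then have "inj_on r {..<k}"
    unfolding inj_on_def by (metis lessThan_iff less_irrefl linorder_neqE_nat)
  then show ?thesis
    using r by (intro exI[of _ "r ` {..<k}"]) (auto simp: card_image p P_def k_def)
qed

text \<open>A root \<open>c\<close> of \<open>P = \<bar>\<alpha>\<bar>\<close> sends the orbit of
  \<open>\<alpha>\<close> to \<open>\<bar>\<alpha>\<bar>\<close>, which has the same image as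
  \<open>\<alpha>\<close>. The real roots exhaust the degree, and the conjugates of a root are again
  roots, so each root is totally real.\<close>

lemma infinite_if_abs_ge_2:
  fixes \<alpha> :: rat
  assumes "\<bar>\<alpha>\<bar> \<ge> 2"
  shows "infinite {c. totally_real c \<and> preperiodic (quad_map c) (of_rat \<alpha>)}" (is "infinite ?S")
proof
  assume fin: "finite ?S"
  define a :: real where "a = of_rat \<bar>\<alpha>\<bar>"
  have "a \<ge> 2" using assms by (metis a_def of_rat_less_eq of_rat_numeral_eq)
  \<comment> \<open>The \<open>2 ^ Suc n\<close> roots found below are too many for a set with
    \<open>n\<close> elements.\<close>
  define n where "n = card ?S"
  define q where "q = orb \<bar>\<alpha>\<bar> (Suc (Suc n)) - [:\<bar>\<alpha>\<bar>:]"
  have q: "rpoly q = (orb (of_rat \<bar>\<alpha>\<bar>) (Suc (Suc n)) - [:of_rat \<bar>\<alpha>\<bar>:] :: 'a::field_char_0 poly)"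
    unfolding q_def by (simp only: rpoly_hom rpoly_orb rpoly_const)
  obtain R where R: "finite R" "card R = 2 ^ Suc n"
      "\<And>r. r \<in> R \<Longrightarrow> poly (orb a (Suc (Suc n))) r = a"
    using orb_eq_self_real_roots[OF \<open>a \<ge> 2\<close>, of n] by blast
  define Z where "Z = {z::complex. poly (rpoly q) z = 0}"
  have deg: "degree q = 2 ^ Suc n"
  proof -
    have "degree (- [:\<bar>\<alpha>\<bar>:]) < degree (orb \<bar>\<alpha>\<bar> (Suc (Suc n)))"
      by (simp add: orb_monic del: orb.simps)
    then have "degree (orb \<bar>\<alpha>\<bar> (Suc (Suc n)) + - [:\<bar>\<alpha>\<bar>:]) = 2 ^ Suc n"
      by (simp only: degree_add_eq_left orb_monic)
    then show ?thesis by (simp only: q_def diff_conv_add_uminus)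
  qed
  then have q0: "q \<noteq> 0" by auto
  have "rpoly q \<noteq> (0 :: complex poly)" using q0 by (simp add: rpoly_eq_0_iff)
  then have Z: "finite Z" "card Z \<le> 2 ^ Suc n"
    using poly_roots_finite[of "rpoly q :: complex poly"] card_poly_roots_bound[of "rpoly q :: complex poly"] deg
    by (simp_all add: Z_def degree_map_poly)
  have sub: "of_real ` R \<subseteq> Z"
  proof
    fix z assume "z \<in> complex_of_real ` R"
    then obtain r where r: "r \<in> R" "z = of_real r" by auto
    have "poly (rpoly q) r = 0"
      using R(3)[OF r(1)] unfolding q a_def by (simp del: orb.simps)
    then show "z \<in> Z" by (simp add: Z_def r poly_rpoly_of_real)
  qed
  moreover have "card (complex_of_real ` R) = 2 ^ Suc n"
    using R by (subst card_image) (auto simp: inj_on_def)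
  ultimately have ZR: "Z = of_real ` R" using Z by (metis card_seteq)
  have "Z \<subseteq> ?S"
  proof
    fix c assume "c \<in> Z"
    then have c: "poly (rpoly q) c = 0" by (simp add: Z_def)
    have "totally_real c"
    proof (rule totally_real_if_all_roots_real[OF q0 c])
      fix z :: complex assume "poly (rpoly q) z = 0"
      then have "z \<in> Z" by (simp add: Z_def)
      then have "z \<in> of_real ` R" using ZR by simp
      then show "z \<in> \<real>" by auto
    qed
    moreover have "preperiodic (quad_map c) (of_rat \<alpha>)"
    proof -
      have orb: "orb (of_rat \<bar>\<alpha>\<bar>) (Suc m) = (orb (of_rat \<alpha>) (Suc m) :: complex poly)" for m
        using orb_abs[of \<alpha> m] by (metis rpoly_orb)
      have "poly (orb (of_rat \<bar>\<alpha>\<bar>) (Suc (Suc n))) c = of_rat \<bar>\<alpha>\<bar>"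
        using c by (simp add: q del: orb.simps)
      then have "poly (orb (of_rat \<bar>\<alpha>\<bar>) (Suc (Suc (Suc n)))) c = poly (orb (of_rat \<bar>\<alpha>\<bar>) (Suc 0)) c"
        by (simp only: poly_orb_Suc) simp
      then show ?thesis unfolding preperiodic_iff_orb orb
        by (intro exI[of _ "Suc 0"] exI[of _ "Suc (Suc (Suc n))"]) simp
    qed
    ultimately show "c \<in> ?S" by simp
  qed
  then have "card Z \<le> n" using fin by (simp add: n_def card_mono)
  moreover have "card Z = 2 ^ Suc n"
    unfolding ZR using R by (subst card_image) (auto simp: inj_on_def)
  ultimately show False using less_exp[of "Suc n"] by linarith
qed

section \<open>Small monic polynomials on the real parameters\<close>

text \<open>\<open>a - a\<^sup>2\<close> is the parameter for which \<open>a\<close> is the larger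
  (or double) fixed point; beyond it, \<open>y\<^sup>2 + c > y\<close> for all
  \<open>y \<ge> \<bar>\<alpha>\<bar>\<close>. The cut-off 1/2 yields the parameter 1/4, above which
  there is no real fixed point. The bounds -8 and 4 are crude escape bounds.\<close>

lemma real_parameter_bounds:
  fixes \<alpha> a c :: real
  assumes a: "\<bar>\<alpha>\<bar> < 2" "a = max \<bar>\<alpha>\<bar> (1/2)"
    and pre: "\<exists>m n. m < n \<and> poly (orb \<alpha> n) c = poly (orb \<alpha> m) c"
  shows "c \<le> a - a\<^sup>2" "-8 \<le> c" "\<bar>poly (orb \<alpha> n) c\<bar> \<le> 4"
proof -
  define x where "x n = poly (orb \<alpha> n) c" for n
  have x: "x 0 = \<alpha>" "x (Suc n) = (x n)\<^sup>2 + c" for n by (simp_all add: x_def)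
  \<comment> \<open>An orbit that increases from some time on in absolute value cannot be preperiodic.\<close>
  have esc: False if "\<And>n. n \<ge> N \<Longrightarrow> \<bar>x n\<bar> < \<bar>x (Suc n)\<bar>" for N
  proof -
    obtain m n where mn: "m < n" "x n = x m" using pre by (auto simp: x_def)
    have shift: "x (n + k) = x (m + k)" for k by (induction k) (simp_all add: mn x)
    have "\<bar>x (m + N + k)\<bar> < \<bar>x (m + N + Suc k)\<bar>" for k using that[of "m + N + k"] by simp
    then have "\<bar>x (m + N)\<bar> < \<bar>x (m + N + k)\<bar>" if "0 < k" for k
      using strict_mono_less[of "\<lambda>k. \<bar>x (m + N + k)\<bar>" 0 k] that
      by (simp add: strict_mono_Suc_iff)
    from this[of "n - m"] show False using shift[of N] mn by (simp add: add_ac)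
  qed
  show c1: "c \<le> a - a\<^sup>2"
  proof (rule ccontr)
    assume c: "\<not> c \<le> a - a\<^sup>2"
    have step: "y < y\<^sup>2 + c" if "y \<ge> \<bar>\<alpha>\<bar>" for y
    proof (cases "\<bar>\<alpha>\<bar> \<ge> 1/2")
      case True
      then have "a = \<bar>\<alpha>\<bar>" using a by simp
      \<comment> \<open>The factors vanish at the two fixed points \<open>a\<close> and
        \<open>1 - a\<close> of the map with parameter \<open>a - a\<^sup>2\<close>.\<close>
      then have "(y - a) * (y + a - 1) \<ge> 0" using that True by (intro mult_nonneg_nonneg) auto
      then show ?thesis using c by (simp add: power2_eq_square algebra_simps)
    next
      case False
      then have "a = 1/2" using a by simp
      then have "c > 1/4" using c unfolding \<open>a = 1/2\<close> by (simp add: power2_eq_square)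
      moreover have "(y - 1/2)\<^sup>2 \<ge> 0" by simp
      then have "y \<le> y\<^sup>2 + 1/4" by (simp add: power2_eq_square algebra_simps)
      ultimately show ?thesis by linarith
    qed
    have ge: "\<bar>\<alpha>\<bar> \<le> \<bar>x n\<bar>" for n
    proof (induction n)
      case (Suc n)
      show ?case using step[OF Suc] Suc by (simp add: x)
    qed (simp add: x)
    show False
      using step[OF ge] by (intro esc[of 0]) (metis abs_ge_self less_le_trans power2_abs x(2))
  qed
  have a2: "a < 2" "a \<ge> 1/2" using a by auto
  have "(a - 1/2)\<^sup>2 \<ge> 0" by simp
  then have c4: "c \<le> 1/4" using c1 by (simp add: power2_eq_square algebra_simps)
  show c8: "-8 \<le> c"
  proof (rule ccontr)
    assume c: "\<not> -8 \<le> c"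
    have al: "\<alpha>\<^sup>2 \<le> 4" using a abs_le_square_iff[of \<alpha> 2] by simp
    have x1: "x 1 \<le> 4 + c" using al by (simp add: x)
    have "(-4 - c)\<^sup>2 \<le> (x 1)\<^sup>2" using x1 c by (intro abs_le_square_iff[THEN iffD1]) auto
    \<comment> \<open>The product is \<open>(4 + c)^2 + 2 * c\<close>, so
      \<open>x 2 \<ge> (4 + c)^2 + c > - c\<close>.\<close>
    moreover have "(-c - 8) * (-c - 2) > 0" using c by (intro mult_pos_pos) auto
    ultimately have x2: "x 2 > - c"
      by (simp add: x numeral_2_eq_2) (simp add: power2_eq_square algebra_simps)
    have step: "y < y\<^sup>2 + c" if "y > - c" for y
    proof -
      have "y * (y - 1) > y * 1" using that c by (intro mult_strict_left_mono) auto
      then show ?thesis using that by (simp add: power2_eq_square algebra_simps)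
    qed
    have ge: "x (2 + n) > - c" for n
    proof (induction n)
      case (Suc n)
      show ?case using step[OF Suc] Suc by (simp add: x)
    qed (use x2 in simp)
    have "\<bar>x n\<bar> < \<bar>x (Suc n)\<bar>" if "n \<ge> 2" for n
    proof -
      have "2 + (n - 2) = n" using that by simp
      then have "x n > - c" using ge[of "n - 2"] by (simp only:)
      then show ?thesis using step[of "x n"] c x(2)[of n] by simp
    qed
    then show False by (rule esc)
  qed
  show "\<bar>poly (orb \<alpha> n) c\<bar> \<le> 4"
  proof (rule ccontr)
    assume n: "\<not> \<bar>poly (orb \<alpha> n) c\<bar> \<le> 4"
    have step: "\<bar>y\<bar> < \<bar>y\<^sup>2 + c\<bar>" if "\<bar>y\<bar> > 4" for y
    proof -
      have "(\<bar>y\<bar> - 4) * (\<bar>y\<bar> + 3) > 0" using that by (intro mult_pos_pos) auto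
      then have "\<bar>y\<bar>\<^sup>2 - \<bar>y\<bar> > 12" by (simp add: power2_eq_square algebra_simps)
      then have "\<bar>y\<bar> < y\<^sup>2 + c" using c8 by simp
      then show ?thesis by linarith
    qed
    have ge: "\<bar>x (n + k)\<bar> > 4" for k
    proof (induction k)
      case (Suc k)
      show ?case using step[OF Suc] Suc by (simp add: x)
    qed (use n in \<open>simp add: x_def\<close>)
    have "\<bar>x k\<bar> < \<bar>x (Suc k)\<bar>" if "k \<ge> n" for k
      using step[OF ge[of "k - n"]] that by (simp add: x)
    then show False by (rule esc)
  qed
qed

section \<open>Growth right of the endpoint: Chebyshev against orbit polynomials\<close>

text \<open>\<open>cheb b n\<close> is the Chebyshev polynomial \<open>T\<close> of index \<open>2\<^sup>n\<close> of the interval \<open>[b - 10, b]\<close>.\<close>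

primrec cheb :: "real \<Rightarrow> nat \<Rightarrow> real poly" where
  "cheb b 0 = [:1 - b / 5, 1 / 5:]"
| "cheb b (Suc n) = smult 2 (cheb b n ^ 2) - 1"

lemma degree_cheb: "degree (cheb b n) \<le> 2 ^ n"
proof (induction n)
  case (Suc n)
  have "degree (smult 2 (cheb b n ^ 2)) \<le> 2 ^ Suc n"
    using degree_power_le[of "cheb b n" 2] Suc by (auto intro: order.trans[OF degree_smult_le])
  then show ?case by (auto intro!: degree_diff_le)
qed simp

lemma abs_cheb_le_1:
  assumes "b - 10 \<le> t" "t \<le> b"
  shows "\<bar>poly (cheb b n) t\<bar> \<le> 1"
proof (induction n)
  case 0
  then show ?case using assms by (simp add: abs_le_iff field_simps)
next
  case (Suc n)
  then have "(poly (cheb b n) t)\<^sup>2 \<le> 1" by (simp add: abs_square_le_1)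
  then show ?case by (simp add: abs_le_iff)
qed

text \<open>The map sending \<open>y\<close> to \<open>2 * y^2 - 1\<close> fixes 1 with derivative
  4; being convex, it stays above its tangent there.\<close>

lemma cheb_growth:
  assumes "s \<ge> 0"
  shows "poly (cheb b n) (b + s) \<ge> 1 + 4 ^ n * (s / 5)"
proof (induction n)
  case 0
  then show ?case by (simp add: field_simps)
next
  case (Suc n)
  have "(1 + 4 ^ n * (s / 5))\<^sup>2 \<le> (poly (cheb b n) (b + s))\<^sup>2"
    using Suc assms by (intro power_mono) auto
  moreover have "(1 + 4 ^ n * (s / 5))\<^sup>2 \<ge> 1 + 2 * (4 ^ n * (s / 5))"
    using zero_le_power2[of "4 ^ n * (s / 5)"] by (simp add: power2_eq_square algebra_simps)
  ultimately show ?case by simp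
qed

text \<open>For values at least 1 the recursion dominates squaring, as
  \<open>2 * y^2 - 1 \<ge> y^2\<close>.\<close>

lemma cheb_squaring:
  assumes "poly (cheb b k) t \<ge> 5"
  shows "poly (cheb b (k + j)) t \<ge> 5 ^ 2 ^ j"
proof (induction j)
  case (Suc j)
  have "(5::real) ^ 2 ^ Suc j = (5 ^ 2 ^ j)\<^sup>2" by (simp add: power_mult[symmetric] mult.commute)
  also have "\<dots> \<le> (poly (cheb b (k + j)) t)\<^sup>2" using Suc by (intro power_mono) auto
  also have "\<dots> \<le> poly (cheb b (k + Suc j)) t"
  proof -
    have "1 \<le> (5::real) ^ 2 ^ j" by simp
    then have "1 \<le> poly (cheb b (k + j)) t" using Suc by linarith
    then have "1 \<le> (poly (cheb b (k + j)) t)\<^sup>2" by simp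
    then show ?thesis by simp
  qed
  finally show ?case .
qed (use assms in simp)

text \<open>At parameter \<open>a - a\<^sup>2\<close> the point \<open>a\<close> is fixed. After a
  shift by \<open>s\<close>, an excess \<open>d\<close> over \<open>a\<close> becomes at most
  \<open>(2 * a + d) * d + s\<close>, and as long as \<open>d \<le> 2 - a\<close> the rate is at
  most \<open>a + 2 < 4\<close>.\<close>

lemma orb_near_fixed:
  fixes \<alpha> a s :: real
  assumes a: "\<bar>\<alpha>\<bar> \<le> a" "a < 2" "1/2 \<le> a" and s: "s \<ge> 0" "s * (a + 2) ^ n \<le> 2 - a"
  shows "\<bar>poly (orb \<alpha> n) (a - a\<^sup>2 + s)\<bar> \<le> a + s * ((a + 2) ^ n - 1)"
  using s(2)
proof (induction n)
  case 0
  then show ?case using a s by simp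
next
  case (Suc n)
  define x where "x = poly (orb \<alpha> n) (a - a\<^sup>2 + s)"
  define e where "e = s * (a + 2) ^ n"
  \<comment> \<open>Subtracting \<open>s\<close> absorbs the shift added in each step:
    \<open>d * (a + 2) + s \<le> e * (a + 2) - s\<close>.\<close>
  define d where "d = e - s"
  have "1 \<le> (a + 2) ^ n" using a by simp
  then have "s * 1 \<le> e" unfolding e_def using s by (intro mult_left_mono) auto
  then have d0: "d \<ge> 0" "e \<ge> 0" using s by (auto simp: d_def)
  have "e * 1 \<le> e * (a + 2)" using d0 a by (intro mult_left_mono) auto
  also have "\<dots> \<le> 2 - a" using Suc.prems by (simp add: e_def mult_ac)
  finally have e2: "e \<le> 2 - a" by simp
  have "\<bar>x\<bar> \<le> a + d" using Suc.IH e2 by (simp add: d_def e_def x_def algebra_simps)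
  then have "x\<^sup>2 \<le> (a + d)\<^sup>2" by (metis abs_ge_zero power2_abs power_mono)
  moreover have "d * d \<le> d * (2 - a)" using d0 e2 s by (intro mult_left_mono) (auto simp: d_def)
  ultimately have "x\<^sup>2 + (a - a\<^sup>2 + s) \<le> a + (d * (a + 2) + s)"
    by (simp add: power2_eq_square algebra_simps)
  moreover have "- (a + (d * (a + 2) + s)) \<le> x\<^sup>2 + (a - a\<^sup>2 + s)"
  proof -
    have "a\<^sup>2 \<le> 2 * a" using a mult_right_mono[of a 2 a] by (simp add: power2_eq_square)
    moreover have "0 \<le> d * (a + 2)" using d0 a by simp
    ultimately show ?thesis using s(1) zero_le_power2[of x] by linarith
  qed
  ultimately have "\<bar>x\<^sup>2 + (a - a\<^sup>2 + s)\<bar> \<le> a + (d * (a + 2) + s)"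
    by (simp add: abs_le_iff)
  also have "\<dots> \<le> a + (e * (a + 2) - s)"
    using s a by (simp add: d_def algebra_simps)
  finally show ?case by (simp add: x_def e_def algebra_simps)
qed

text \<open>The halved bound leaves room for the parameter:
  \<open>y * y / 4 + 2 \<le> y * y / 2\<close> for \<open>y \<ge> 4\<close>.\<close>

lemma orb_doubly_exp:
  fixes \<alpha> t :: real
  assumes "\<bar>poly (orb \<alpha> m) t\<bar> \<le> 2" "\<bar>t\<bar> \<le> 2"
  shows "\<bar>poly (orb \<alpha> (m + j)) t\<bar> \<le> 4 ^ 2 ^ j / 2"
proof (induction j)
  case (Suc j)
  define y where "y = (4::real) ^ 2 ^ j"
  have "4 ^ 1 \<le> y" unfolding y_def by (intro power_increasing) auto
  then have "y * y \<ge> 4 * 4" by (intro mult_mono) auto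
  have "(poly (orb \<alpha> (m + j)) t)\<^sup>2 \<le> (y / 2)\<^sup>2"
    using Suc unfolding y_def by (metis abs_ge_zero power2_abs power_mono)
  moreover have "(y / 2)\<^sup>2 = y * y / 4" by (simp add: power2_eq_square)
  ultimately have "\<bar>(poly (orb \<alpha> (m + j)) t)\<^sup>2 + t\<bar> \<le> y * y / 2"
    using assms(2) \<open>y * y \<ge> 4 * 4\<close> zero_le_power2[of "poly (orb \<alpha> (m + j)) t"] by linarith
  also have "y * y = 4 ^ 2 ^ Suc j" by (simp add: y_def power_add[symmetric] mult_2)
  finally show ?case by simp
qed (use assms in simp)

text \<open>At a suitable index the orbit value is still at most 2 while the Chebyshev value is
  already at least 5, because the growth rates are \<open>a + 2\<close> and 4. From then on both are
  essentially squared in each step, and the ratio is at most a power of 4/5. The shift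
  \<open>n + 2\<close> gives the orbit polynomial twice the degree of \<open>cheb\<close>.\<close>

lemma orb_cheb_ratio_tendsto_0:
  fixes \<alpha> a :: real
  assumes a: "\<bar>\<alpha>\<bar> \<le> a" "a < 2" "1/2 \<le> a"
  obtains t0 where "t0 > 0"
    "\<And>s. t0 / 2 \<le> s \<Longrightarrow> s \<le> t0 \<Longrightarrow>
       (\<lambda>n. poly (orb \<alpha> (n + 2)) (a - a\<^sup>2 + s) / poly (cheb (a - a\<^sup>2) n) (a - a\<^sup>2 + s)) \<longlonglongrightarrow> 0"
proof -
  \<comment> \<open>\<open>k\<close> is large enough for \<open>4 ^ k * t0 \<ge> 40\<close>; then
    \<open>s \<ge> t0 / 2\<close> gives \<open>1 + 4 ^ k * (s / 5) \<ge> 5\<close>. The value of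
    \<open>t0\<close> is the largest shift that \<open>orb_near_fixed\<close> admits at index
    \<open>k + 2\<close>.\<close>
  obtain k where k: "40 * (a + 2)\<^sup>2 / (2 - a) < (4 / (a + 2)) ^ k"
    using real_arch_pow[of "4 / (a + 2)"] a by auto
  define t0 where "t0 = (2 - a) / (a + 2) ^ (k + 2)"
  have pos: "(a + 2) ^ (k + 2) > 0" "(a + 2) ^ k > 0" using a by auto
  have ge1: "(a + 2) ^ (k + 2) \<ge> 1" by (rule one_le_power) (use a in simp)
  have t0: "t0 > 0" using pos a by (simp add: t0_def)
  have "t0 \<le> (2 - a) / 1" unfolding t0_def using pos ge1 a by (intro divide_left_mono) auto
  then have t0': "t0 \<le> 3 / 2" using a by simp
  have k': "40 \<le> 4 ^ k * t0"
  proof -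
    have "40 = 40 * (a + 2)\<^sup>2 / (2 - a) * ((2 - a) / (a + 2)\<^sup>2)" using a by simp
    also have "\<dots> \<le> (4 / (a + 2)) ^ k * ((2 - a) / (a + 2)\<^sup>2)"
      using k a by (intro mult_right_mono) auto
    also have "\<dots> = 4 ^ k * t0" by (simp add: t0_def power_add power_divide power2_eq_square)
    finally show ?thesis .
  qed
  show ?thesis
  proof (rule that[OF t0])
    fix s assume s: "t0 / 2 \<le> s" "s \<le> t0"
    define b where "b = a - a\<^sup>2"
    have "a\<^sup>2 \<le> 2 * a" using a mult_right_mono[of a 2 a] by (simp add: power2_eq_square)
    moreover have "(a - 1/2)\<^sup>2 \<ge> 0" by simp
    then have "a \<le> a\<^sup>2 + 1/4" by (simp add: power2_eq_square algebra_simps)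
    ultimately have b: "\<bar>b + s\<bar> \<le> 2" using a s t0 t0' unfolding b_def by linarith
    have s': "s * (a + 2) ^ (k + 2) \<le> 2 - a"
      using s pos by (simp add: t0_def pos_le_divide_eq del: power_add)
    have "\<bar>poly (orb \<alpha> (k + 2)) (b + s)\<bar> \<le> a + s * ((a + 2) ^ (k + 2) - 1)"
      unfolding b_def using a s t0 s' by (intro orb_near_fixed) auto
    also have "\<dots> \<le> 2" using s' s t0 by (simp only: right_diff_distrib)
    finally have P: "\<bar>poly (orb \<alpha> (k + 2)) (b + s)\<bar> \<le> 2" .
    have "4 ^ k * t0 \<le> 4 ^ k * (2 * s)" using s by (intro mult_left_mono) auto
    then have "5 \<le> 1 + 4 ^ k * (s / 5)" using k' by linarith
    also have "\<dots> \<le> poly (cheb b k) (b + s)" using s t0 by (intro cheb_growth) auto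
    finally have T: "5 \<le> poly (cheb b k) (b + s)" .
    have "\<bar>poly (orb \<alpha> (j + k + 2)) (b + s) / poly (cheb b (j + k)) (b + s)\<bar> \<le> (4 / 5) ^ j" for j
    proof -
      have "\<bar>poly (orb \<alpha> (k + 2 + j)) (b + s)\<bar> \<le> 4 ^ 2 ^ j"
        using orb_doubly_exp[OF P b, of j] zero_le_power[of "4::real" "2 ^ j"] by linarith
      moreover have "5 ^ 2 ^ j \<le> poly (cheb b (k + j)) (b + s)" by (rule cheb_squaring[OF T])
      ultimately have "\<bar>poly (orb \<alpha> (k + 2 + j)) (b + s)\<bar> / poly (cheb b (k + j)) (b + s) \<le> 4 ^ 2 ^ j / 5 ^ 2 ^ j"
        by (intro frac_le) auto
      also have "\<dots> = (4 / 5 :: real) ^ 2 ^ j" by (simp add: power_divide)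
      also have "\<dots> \<le> (4 / 5) ^ j" using less_exp[of j] by (intro power_decreasing) auto
      finally have le: "\<bar>poly (orb \<alpha> (k + 2 + j)) (b + s)\<bar> / poly (cheb b (k + j)) (b + s) \<le> (4 / 5) ^ j" .
      have "poly (cheb b (k + j)) (b + s) > 0"
        using \<open>5 ^ 2 ^ j \<le> poly (cheb b (k + j)) (b + s)\<close> by (rule less_le_trans[rotated]) simp
      moreover have "k + 2 + j = j + k + 2" "k + j = j + k" by simp_all
      ultimately show ?thesis using le by (simp only: abs_divide abs_of_pos)
    qed
    moreover have "(\<lambda>j. (4 / 5 :: real) ^ j) \<longlonglongrightarrow> 0" by (rule LIMSEQ_realpow_zero) auto
    ultimately have "(\<lambda>j. poly (orb \<alpha> (j + k + 2)) (b + s) / poly (cheb b (j + k)) (b + s)) \<longlonglongrightarrow> 0"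
      by (elim tendsto_0_le[where K = 1]) (simp del: orb.simps cheb.simps)
    then show "(\<lambda>n. poly (orb \<alpha> (n + 2)) (a - a\<^sup>2 + s) / poly (cheb (a - a\<^sup>2) n) (a - a\<^sup>2 + s)) \<longlonglongrightarrow> 0"
      unfolding b_def[symmetric]
      by (rule LIMSEQ_offset[where k = k])
  qed
qed

section \<open>Shrinking a sup norm by exchanging zeros\<close>

text \<open>Subtracting a multiple of \<open>T\<close> creates a zero at \<open>x1\<close>, which is
  then moved to \<open>b\<close>; since \<open>T\<close> has smaller degree, the polynomial stays
  monic. The product form of the identity avoids dividing by \<open>x - x1\<close>.\<close>

lemma replace_root:
  fixes H T :: "real poly"
  assumes "lead_coeff H = 1" "degree T < degree H" "poly T x1 \<noteq> 0"
  obtains G where "degree G = degree H" "lead_coeff G = 1"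
    "\<And>x. poly G x * (x - x1) = (poly H x - poly H x1 / poly T x1 * poly T x) * (x - b)"
proof -
  define k where "k = poly H x1 / poly T x1"
  define F where "F = H + smult (- k) T"
  have lt: "degree (smult (- k) T) < degree H"
    using degree_smult_le[of "- k" T] assms(2) by linarith
  have F: "degree F = degree H" "lead_coeff F = 1"
    using degree_add_eq_left[OF lt] lead_coeff_add_le[OF lt] assms(1)
    by (simp_all add: F_def add.commute)
  have "poly F x1 = 0" using assms(3) by (simp add: F_def k_def)
  then obtain W where W: "F = [:- x1, 1:] * W" by (auto simp: poly_eq_0_iff_dvd elim: dvdE)
  have "F \<noteq> 0" using F by auto
  then have W0: "W \<noteq> 0" using W by auto
  have "degree F = degree [:- x1, 1:] + degree W" "lead_coeff F = lead_coeff [:- x1, 1:] * lead_coeff W"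
    unfolding W using W0 by (intro degree_mult_eq lead_coeff_mult; simp)+
  then have "degree W + 1 = degree H" "lead_coeff W = 1" using F by simp_all
  moreover have "degree ([:- b, 1:] * W) = degree [:- b, 1:] + degree W"
    "lead_coeff ([:- b, 1:] * W) = lead_coeff [:- b, 1:] * lead_coeff W"
    using W0 by (intro degree_mult_eq lead_coeff_mult; simp)+
  ultimately have "degree ([:- b, 1:] * W) = degree H" "lead_coeff ([:- b, 1:] * W) = 1" by simp_all
  moreover have "poly ([:- b, 1:] * W) x * (x - x1)
      = (poly H x - poly H x1 / poly T x1 * poly T x) * (x - b)" for x
  proof -
    have "poly ([:- b, 1:] * W) x * (x - x1) = poly F x * (x - b)" by (simp add: W algebra_simps)
    also have "poly F x = poly H x - poly H x1 / poly T x1 * poly T x"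
      by (simp add: F_def k_def)
    finally show ?thesis .
  qed
  ultimately show ?thesis using that by blast
qed

text \<open>Each exchange of a zero multiplies the bound on \<open>E\<close> by a factor below 1
  fixed in advance. The perturbation is small for large \<open>n\<close>, and off the chosen zeros
  the ratio to \<open>T n\<close> still tends to 0, so that the exchange can be repeated.\<close>

lemma shrink:
  fixes H T :: "nat \<Rightarrow> real poly"
  assumes H: "\<And>n. degree (H n) = d n" "\<And>n. lead_coeff (H n) = 1"
    and T: "\<And>n. degree (T n) < d n" "\<And>n t. t \<in> E \<Longrightarrow> \<bar>poly (T n) t\<bar> \<le> 1"
    and E: "E \<subseteq> {b - 10..b}"
    and s: "0 < s"
    and Tpos: "\<And>n x. b < x \<Longrightarrow> poly (T n) x > 0"
    and bnd: "0 < B" "\<And>n t. t \<in> E \<Longrightarrow> \<bar>poly (H n) t\<bar> \<le> B"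
    and lim: "\<And>x. b + s / 2 < x \<Longrightarrow> x < b + s \<Longrightarrow> (\<lambda>n. poly (H n) x / poly (T n) x) \<longlonglongrightarrow> 0"
    and "\<epsilon> > 0"
  shows "\<exists>n G. degree G = d n \<and> lead_coeff G = 1 \<and> (\<forall>t\<in>E. \<bar>poly G t\<bar> \<le> \<epsilon>)"
proof -
  define I where "I = {b + s / 2<..<b + s}"
  \<comment> \<open>\<open>q\<close> bounds \<open>(b - t) / (x1 - t)\<close> for \<open>t\<close>
    in \<open>E\<close> and \<open>x1 > b + s / 2\<close>; the larger \<open>q'\<close> leaves room
    for the perturbation.\<close>
  define q where "q = 10 / (10 + s / 2)"
  define q' where "q' = (1 + q) / 2"
  have q: "0 < q" "q < 1" using s by (auto simp: q_def)
  then have q': "q < q'" "0 < q'" "q' < 1" by (auto simp: q'_def)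
  \<comment> \<open>\<open>X\<close> collects the zeros already used; it stays finite while
    \<open>I\<close> is infinite.\<close>
  have "\<exists>K X. finite X \<and> (\<forall>n. degree (K n) = d n \<and> lead_coeff (K n) = 1) \<and>
      (\<forall>\<^sub>F n in sequentially. \<forall>t\<in>E. \<bar>poly (K n) t\<bar> \<le> B * q' ^ m) \<and>
      (\<forall>x\<in>I - X. (\<lambda>n. poly (K n) x / poly (T n) x) \<longlonglongrightarrow> 0)" for m
  proof (induction m)
    case 0
    show ?case using H bnd lim by (intro exI[of _ H] exI[of _ "{}"]) (auto simp: I_def)
  next
    case (Suc m)
    then obtain K X where X: "finite X" and K: "\<And>n. degree (K n) = d n" "\<And>n. lead_coeff (K n) = 1"
      and Kb: "\<forall>\<^sub>F n in sequentially. \<forall>t\<in>E. \<bar>poly (K n) t\<bar> \<le> B * q' ^ m"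
      and Kl: "\<And>x. x \<in> I - X \<Longrightarrow> (\<lambda>n. poly (K n) x / poly (T n) x) \<longlonglongrightarrow> 0" by blast
    have "infinite (I - X)" using X s by (intro Diff_infinite_finite) (auto simp: I_def infinite_Ioo)
    then obtain x1 where x1: "x1 \<in> I - X" using infinite_imp_nonempty by blast
    then have b1: "b < x1" "b + s / 2 < x1" using s by (auto simp: I_def)
    define \<kappa> where "\<kappa> n = poly (K n) x1 / poly (T n) x1" for n
    have "\<exists>G. degree G = d n \<and> lead_coeff G = 1 \<and>
        (\<forall>x. poly G x * (x - x1) = (poly (K n) x - \<kappa> n * poly (T n) x) * (x - b))" for n
      using replace_root[of "K n" "T n" x1 b] K T(1)[of n] Tpos[OF b1(1), of n]
      unfolding \<kappa>_def by (metis less_irrefl)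
    then obtain G where G: "\<And>n. degree (G n) = d n" "\<And>n. lead_coeff (G n) = 1"
      "\<And>n x. poly (G n) x * (x - x1) = (poly (K n) x - \<kappa> n * poly (T n) x) * (x - b)"
      by metis
    have \<kappa>: "\<kappa> \<longlonglongrightarrow> 0" unfolding \<kappa>_def using Kl[OF x1] .
    \<comment> \<open>Chosen so that
      \<open>(B * q' ^ m + \<delta>) * q = B * q' ^ Suc m\<close>.\<close>
    define \<delta> where "\<delta> = B * q' ^ m * (q' / q - 1)"
    have "\<delta> > 0" unfolding \<delta>_def using bnd q q' by (intro mult_pos_pos) (auto simp: field_simps)
    then have "\<forall>\<^sub>F n in sequentially. \<bar>\<kappa> n\<bar> < \<delta>"
      using \<kappa> by (auto dest!: tendstoD[of _ _ _ \<delta>] simp: dist_real_def)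
    with Kb have "\<forall>\<^sub>F n in sequentially. \<forall>t\<in>E. \<bar>poly (G n) t\<bar> \<le> B * q' ^ Suc m"
    proof eventually_elim
      case (elim n)
      show ?case
      proof
        fix t assume t: "t \<in> E"
        then have tb: "b - 10 \<le> t" "t \<le> b" using E by auto
        then have neg: "t - x1 < 0" using b1 by simp
        define y where "y = poly (K n) t - \<kappa> n * poly (T n) t"
        have "\<bar>\<kappa> n * poly (T n) t\<bar> \<le> \<delta> * 1"
          unfolding abs_mult using elim T(2)[OF t, of n] by (intro mult_mono) auto
        then have y: "\<bar>y\<bar> \<le> B * q' ^ m + \<delta>" using elim t unfolding y_def by fastforce
        have "\<bar>poly (G n) t\<bar> = \<bar>y\<bar> * ((b - t) / (x1 - t))"
        proof -
          have "poly (G n) t = y * ((b - t) / (x1 - t))"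
            using G(3)[of n t] neg by (simp add: y_def field_simps)
          then show ?thesis using neg tb by (simp add: abs_mult)
        qed
        also have "(b - t) / (x1 - t) \<le> q"
        proof -
          have "(b - t) * (s / 2) \<le> 10 * (x1 - b)" using tb b1 s by (intro mult_mono) auto
          then show ?thesis using neg s by (simp add: q_def field_simps)
        qed
        then have "\<bar>y\<bar> * ((b - t) / (x1 - t)) \<le> (B * q' ^ m + \<delta>) * q"
          using y neg tb by (intro mult_mono) auto
        also have "\<dots> = B * q' ^ Suc m" using q by (simp add: \<delta>_def field_simps)
        finally show "\<bar>poly (G n) t\<bar> \<le> B * q' ^ Suc m" .
      qed
    qed
    moreover have "(\<lambda>n. poly (G n) x / poly (T n) x) \<longlonglongrightarrow> 0" if x: "x \<in> I - insert x1 X" for x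
    proof -
      have xb: "b < x" using x s by (auto simp: I_def)
      have "poly (G n) x / poly (T n) x = (poly (K n) x / poly (T n) x - \<kappa> n) * ((x - b) / (x - x1))" for n
        using G(3)[of n x] Tpos[OF xb, of n] x by (simp add: field_simps)
      moreover have "(\<lambda>n. (poly (K n) x / poly (T n) x - \<kappa> n) * ((x - b) / (x - x1))) \<longlonglongrightarrow> (0 - 0) * ((x - b) / (x - x1))"
        using x by (intro tendsto_intros Kl \<kappa>) auto
      ultimately show ?thesis by simp
    qed
    ultimately show ?case using X G
      by (intro exI[of _ G] exI[of _ "insert x1 X"]) blast
  qed
  note * = this
  obtain m where m: "q' ^ m < \<epsilon> / B"
    using real_arch_pow_inv[of "\<epsilon> / B" q'] \<open>\<epsilon> > 0\<close> bnd q' by auto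
  obtain K where K: "\<And>n. degree (K n) = d n" "\<And>n. lead_coeff (K n) = 1"
      and Kb: "\<forall>\<^sub>F n in sequentially. \<forall>t\<in>E. \<bar>poly (K n) t\<bar> \<le> B * q' ^ m"
    using *[of m] by blast
  obtain n where "\<forall>t\<in>E. \<bar>poly (K n) t\<bar> \<le> B * q' ^ m"
    using eventually_happens'[OF sequentially_bot Kb] by blast
  moreover have "B * q' ^ m \<le> \<epsilon>" using m bnd by (simp add: field_simps)
  ultimately show ?thesis using K by (intro exI[of _ n] exI[of _ "K n"]) force
qed

text \<open>The degree is that of the orbit polynomial with index \<open>n + 2\<close>; this allows
  powers of \<open>G\<close> to be matched later with powers of that orbit polynomial.\<close>

lemma small_monic_poly:
  fixes \<alpha> a \<epsilon> :: real
  assumes a: "\<bar>\<alpha>\<bar> \<le> a" "a < 2" "1/2 \<le> a"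
    and E: "\<And>t. t \<in> E \<Longrightarrow> -8 \<le> t \<and> t \<le> a - a\<^sup>2 \<and> (\<forall>n. \<bar>poly (orb \<alpha> n) t\<bar> \<le> 4)"
    and "\<epsilon> > 0"
  shows "\<exists>n G. degree G = 2 ^ Suc n \<and> lead_coeff G = 1 \<and> (\<forall>t\<in>E. \<bar>poly G t\<bar> \<le> \<epsilon>)"
proof -
  define b where "b = a - a\<^sup>2"
  obtain t0 where t0: "t0 > 0"
    "\<And>s. t0 / 2 \<le> s \<Longrightarrow> s \<le> t0 \<Longrightarrow>
       (\<lambda>n. poly (orb \<alpha> (n + 2)) (b + s) / poly (cheb b n) (b + s)) \<longlonglongrightarrow> 0"
    using orb_cheb_ratio_tendsto_0[OF a] unfolding b_def by blast
  have "(a - 1/2)\<^sup>2 \<ge> 0" by simp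
  then have b: "b \<le> 1 / 4" by (simp add: b_def power2_eq_square algebra_simps)
  have Eb: "E \<subseteq> {b - 10..b}" using E b by (force simp: b_def)
  show ?thesis
  proof (rule shrink[where H = "\<lambda>n. orb \<alpha> (n + 2)" and T = "cheb b" and d = "\<lambda>n. 2 ^ Suc n"
        and b = b and s = t0 and B = 4, OF _ _ _ _ Eb t0(1) _ _ _ _ \<open>\<epsilon> > 0\<close>])
    show "degree (orb \<alpha> (n + 2)) = 2 ^ Suc n" "lead_coeff (orb \<alpha> (n + 2)) = 1" for n
      using orb_monic[of \<alpha> "Suc n"] by (simp_all add: numeral_2_eq_2 del: orb.simps)
    show "degree (cheb b n) < 2 ^ Suc n" for n
      using degree_cheb[of b n] by (rule le_less_trans) simp
    show "\<bar>poly (cheb b n) t\<bar> \<le> 1" if "t \<in> E" for n t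
      using that Eb by (intro abs_cheb_le_1) auto
    show "0 < poly (cheb b n) x" if "b < x" for n x
    proof -
      have "0 < 1 + 4 ^ n * ((x - b) / 5)" using that by (intro add_pos_nonneg) auto
      also have "\<dots> \<le> poly (cheb b n) x" using cheb_growth[of "x - b" n b] that by simp
      finally show ?thesis .
    qed
    show "\<bar>poly (orb \<alpha> (n + 2)) t\<bar> \<le> 4" if "t \<in> E" for n t using E[OF that] by blast
    show "(\<lambda>n. poly (orb \<alpha> (n + 2)) x / poly (cheb b n) x) \<longlonglongrightarrow> 0"
      if "b + t0 / 2 < x" "x < b + t0" for x
      using t0(2)[of "x - b"] that by simp
  qed simp
qed

section \<open>Integral values with small conjugates\<close>

text \<open>When \<open>b\<close> clears the denominator of \<open>\<alpha>\<close>, the factor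
  \<open>b\<close> makes the values at parameters with preperiodic \<open>\<alpha>\<close> algebraic
  integers.\<close>

inductive_set int_orb :: "rat \<Rightarrow> int \<Rightarrow> rat poly set" for \<alpha> b where
  const: "[:of_int k:] \<in> int_orb \<alpha> b"
| orb: "smult (of_int b) (orb \<alpha> n) \<in> int_orb \<alpha> b"
| add: "p \<in> int_orb \<alpha> b \<Longrightarrow> q \<in> int_orb \<alpha> b \<Longrightarrow> p + q \<in> int_orb \<alpha> b"
| mult: "p \<in> int_orb \<alpha> b \<Longrightarrow> q \<in> int_orb \<alpha> b \<Longrightarrow> p * q \<in> int_orb \<alpha> b"

lemma int_orb_power: "p \<in> int_orb \<alpha> b \<Longrightarrow> p ^ n \<in> int_orb \<alpha> b"
proof (induction n)
  case 0
  show ?case using int_orb.const[of 1] by (simp add: one_pCons)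
qed (auto intro: int_orb.mult)

lemma int_orb_smult_of_int: "p \<in> int_orb \<alpha> b \<Longrightarrow> smult (of_int k) p \<in> int_orb \<alpha> b"
  using int_orb.mult[OF int_orb.const[of k \<alpha> b], of p] by simp

lemma int_orb_diff: "p \<in> int_orb \<alpha> b \<Longrightarrow> q \<in> int_orb \<alpha> b \<Longrightarrow> p - q \<in> int_orb \<alpha> b"
  using int_orb.add[OF _ int_orb_smult_of_int[of q \<alpha> b "-1"], of p] by simp

section \<open>Values as integer combinations of finitely many generators\<close>

text \<open>The additive subgroup generated by \<open>S\<close>. Integrality is expressed below as
  membership in the span of a finite \<open>S\<close>, which bounds the denominators of all powers
  at once.\<close>

inductive_set int_span :: "'a::ab_group_add set \<Rightarrow> 'a set" for S where
  zero: "0 \<in> int_span S"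
| add: "x \<in> int_span S \<Longrightarrow> s \<in> S \<Longrightarrow> x + s \<in> int_span S"
| diff: "x \<in> int_span S \<Longrightarrow> s \<in> S \<Longrightarrow> x - s \<in> int_span S"

lemma int_span_base: "s \<in> S \<Longrightarrow> s \<in> int_span S"
  using int_span.add[OF int_span.zero] by simp

lemma int_span_add:
  assumes "x \<in> int_span S" "y \<in> int_span S"
  shows "x + y \<in> int_span S"
  using assms(2,1)
  by (induction rule: int_span.induct)
     (auto simp: add.assoc[symmetric] add_diff_eq intro: int_span.intros)

lemma int_span_minus:
  assumes "x \<in> int_span S"
  shows "- x \<in> int_span S"
  using assms
proof (induction rule: int_span.induct)
  case (add x s)
  then show ?case using int_span.diff[of "- x" S s] by simp
next
  case (diff x s)
  then show ?case using int_span.add[of "- x" S s] by simp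
qed (auto intro: int_span.intros)

lemma int_span_diff: "x \<in> int_span S \<Longrightarrow> y \<in> int_span S \<Longrightarrow> x - y \<in> int_span S"
  using int_span_add[of x S "- y"] int_span_minus[of y S] by simp

lemma int_span_of_int_mult:
  fixes x :: "'a::comm_ring_1"
  assumes "x \<in> int_span S"
  shows "of_int k * x \<in> int_span S"
proof -
  have *: "of_nat n * x \<in> int_span S" for n
    by (induction n) (auto simp: distrib_right intro: int_span.zero int_span_add assms)
  show ?thesis using *[of "nat k"] int_span_minus[OF *[of "nat (- k)"]]
    by (cases "k \<ge> 0") (simp_all add: of_nat_nat)
qed

lemma int_span_mult:
  fixes z :: "'a::comm_ring_1"
  assumes "\<And>s. s \<in> S \<Longrightarrow> z * s \<in> int_span S" and "x \<in> int_span S"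
  shows "z * x \<in> int_span S"
  using assms(2)
  by (induction rule: int_span.induct)
     (auto simp: distrib_left right_diff_distrib intro: int_span.zero int_span_add int_span_diff assms(1))

text \<open>With \<open>y\<^sub>i = b f\<^sup>i(\<alpha>)\<close> and \<open>b \<alpha> = r \<in> \<int>\<close> one has \<open>y\<^sub>i\<^sup>2 = b y\<^sub>i\<^sub>+\<^sub>1 - b y\<^sub>1 + r\<^sup>2\<close>: squares
  reduce to linear terms, so finitely many squarefree monomials generate \<open>\<int>[y\<^sub>0, y\<^sub>1, \<dots>]\<close> as an
  additive group.\<close>

lemma squarefree_span_mult:
  fixes y :: "nat \<Rightarrow> 'a::comm_ring_1"
  assumes sq: "\<And>i. (y i)\<^sup>2 = of_int b * y (Suc i) - of_int b * y 1 + of_int e"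
    and per: "\<And>i. \<exists>j<n. y i = y j"
    and S: "S = (\<lambda>A. \<Prod>i\<in>A. y i) ` Pow {..<n}"
  shows "s \<in> S \<Longrightarrow> y i * s \<in> int_span S"
    and "x \<in> int_span S \<Longrightarrow> z \<in> int_span S \<Longrightarrow> z * x \<in> int_span S"
proof -
  have gen: "y i * (\<Prod>i\<in>A. y i) \<in> int_span S" if "A \<subseteq> {..<n}" for i A
    using that
  \<comment> \<open>If \<open>j \<in> A\<close>, replacing \<open>(y j)\<^sup>2\<close> through
    \<open>sq\<close> leaves products over \<open>A - {j}\<close> with at most one further factor,
    so the size of \<open>A\<close> drops.\<close>
  proof (induction "card A" arbitrary: A i)
    case 0
    then have A: "A = {}" using finite_subset by fastforce
    obtain j where "j < n" "y i = y j" using per by blast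
    then have "y i * (\<Prod>i\<in>A. y i) \<in> S" unfolding S A by (intro image_eqI[of _ _ "{j}"]) auto
    then show ?case by (rule int_span_base)
  next
    case (Suc m)
    have fin: "finite A" using Suc.prems finite_subset by blast
    obtain j where j: "j < n" "y i = y j" using per by blast
    show ?case
    proof (cases "j \<in> A")
      case False
      then have "y i * (\<Prod>i\<in>A. y i) = (\<Prod>i\<in>insert j A. y i)" using fin j by simp
      also have "\<dots> \<in> S" unfolding S using Suc.prems j by (intro imageI) auto
      finally show ?thesis by (rule int_span_base)
    next
      case True
      define P where "P = (\<Prod>i\<in>A - {j}. y i)"
      have "(\<Prod>i\<in>A. y i) = y j * P" using fin True by (simp add: P_def prod.remove)
      then have "y i * (\<Prod>i\<in>A. y i) = (y j)\<^sup>2 * P" using j by (simp add: power2_eq_square mult_ac)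
      also have "\<dots> = of_int b * (y (Suc j) * P) - of_int b * (y 1 * P) + of_int e * P"
        by (simp add: sq algebra_simps)
      also have "\<dots> \<in> int_span S"
      proof -
        have "card (A - {j}) = m" using Suc.hyps(2) True fin by simp
        then have "y k * P \<in> int_span S" for k
          unfolding P_def using Suc.hyps(1)[of "A - {j}" k] Suc.prems by auto
        moreover have "P \<in> int_span S" unfolding P_def S using Suc.prems
          by (intro int_span_base imageI) auto
        ultimately show ?thesis by (intro int_span_add int_span_diff int_span_of_int_mult)
      qed
      finally show ?thesis .
    qed
  qed
  then show yS: "y i * s \<in> int_span S" if "s \<in> S" for i s using that by (auto simp: S)
  have "(\<Prod>i\<in>A. y i) * x \<in> int_span S" if "x \<in> int_span S" "finite A" for A x
    using that(2)
  proof (induction A)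
    case empty
    then show ?case using that by simp
  next
    case (insert i A)
    then show ?case using int_span_mult[OF yS, of "(\<Prod>i\<in>A. y i) * x" i] by (simp add: mult.assoc)
  qed
  then have Sx: "s * x \<in> int_span S" if "x \<in> int_span S" "s \<in> S" for s x
    using that unfolding S by (metis (no_types, lifting) PowD finite_lessThan finite_subset imageE)
  show "z * x \<in> int_span S" if "x \<in> int_span S" "z \<in> int_span S"
    using int_span_mult[of S x z] Sx that by (metis mult.commute)
qed

text \<open>Preperiodicity folds every index to one below \<open>n\<close>, so squarefree products
  of the first \<open>n\<close> values suffice. \<open>M\<close> consists of polynomials, not of
  values, because they are reduced modulo the minimal polynomial later.\<close>

lemma int_orb_values_in_span:
  fixes c :: complex
  assumes b: "of_int b * \<alpha> = of_int r"
    and pre: "preperiodic (quad_map c) (of_rat \<alpha>)"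
  obtains M where "finite M"
    "\<And>p. p \<in> int_orb \<alpha> b \<Longrightarrow> poly (rpoly p) c \<in> int_span ((\<lambda>p. poly (rpoly p) c) ` M)"
proof -
  define x where "x i = poly (orb (of_rat \<alpha>) i) c" for i
  have x: "x 0 = of_rat \<alpha>" "x (Suc i) = (x i)\<^sup>2 + c" for i by (simp_all add: x_def)
  define y where "y i = of_int b * x i" for i
  have br: "of_int b * of_rat \<alpha> = (of_int r :: complex)"
    using b by (metis of_rat_mult of_rat_of_int_eq)
  \<comment> \<open>The parameter is eliminated by \<open>b^2 * c = b * y 1 - r^2\<close>, which
    comes from \<open>x 1 = \<alpha>^2 + c\<close>.\<close>
  have sq: "(y i)\<^sup>2 = of_int b * y (Suc i) - of_int b * y 1 + of_int (r\<^sup>2)" for i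
  proof -
    have "(of_int b * of_rat \<alpha>)\<^sup>2 = ((of_int r)\<^sup>2 :: complex)" by (simp add: br)
    then show ?thesis by (simp add: y_def x power2_eq_square algebra_simps)
  qed
  obtain m n where mn: "m < n" "x n = x m"
    using pre by (auto simp: preperiodic_iff_orb x_def)
  have per: "\<exists>j<n. y i = y j" for i
  proof (induction i)
    case 0
    then show ?case using mn by (intro exI[of _ 0]) auto
  next
    case (Suc i)
    then obtain j where j: "j < n" "y i = y j" by blast
    have "y (Suc i) = y (Suc j)"
    proof (cases "b = 0")
      case False
      then have "x i = x j" using j by (simp add: y_def)
      then show ?thesis by (simp add: y_def x)
    qed (simp add: y_def)
    \<comment> \<open>The index \<open>n\<close> wraps around to \<open>m\<close>, as
      \<open>x n = x m\<close>.\<close>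
    then show ?case
      using j(1) mn exI[of "\<lambda>j'. j' < n \<and> y (Suc i) = y j'" "if Suc j = n then m else Suc j"]
      by (auto simp: y_def split: if_splits)
  qed
  define M where "M = (\<lambda>A. \<Prod>i\<in>A. smult (of_int b) (orb \<alpha> i)) ` Pow {..<n}"
  define S where "S = (\<lambda>A. \<Prod>i\<in>A. y i) ` Pow {..<n}"
  have y: "poly (rpoly (smult (of_int b) (orb \<alpha> i))) c = y i" for i
    by (simp add: rpoly_hom rpoly_orb y_def x_def)
  have "poly (rpoly (\<Prod>i\<in>A. smult (of_int b) (orb \<alpha> i))) c = (\<Prod>i\<in>A. y i)" for A
    by (induction A rule: infinite_finite_induct) (simp_all add: rpoly_hom(4) y del: mult_smult_left)
  then have S': "S = (\<lambda>p. poly (rpoly p) c) ` M"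
    by (simp add: S_def M_def image_image)
  have one: "1 \<in> int_span S" unfolding S_def by (intro int_span_base image_eqI[of _ _ "{}"]) auto
  have "poly (rpoly p) c \<in> int_span S" if "p \<in> int_orb \<alpha> b" for p
    using that
  proof (induction rule: int_orb.induct)
    case (const k)
    then show ?case using int_span_of_int_mult[OF one, of k] by (simp add: rpoly_const)
  next
    case (orb i)
    obtain j where "j < n" "y i = y j" using per by blast
    then have "y i \<in> S" unfolding S_def by (intro image_eqI[of _ _ "{j}"]) auto
    then show ?case unfolding y by (rule int_span_base)
  next
    case (add p q)
    then show ?case by (simp add: rpoly_hom int_span_add)
  next
    case (mult p q)
    then show ?case
      using squarefree_span_mult(2)[OF sq per S_def] by (simp add: rpoly_hom(4))
  qed
  moreover have "finite M" by (simp add: M_def)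
  ultimately show ?thesis using that S' by blast
qed

section \<open>Bounded denominators and interpolation at the conjugates\<close>

lemma common_denominator:
  assumes "finite (M :: rat poly set)"
  obtains D :: int where "D > 0" "\<And>p i. p \<in> M \<Longrightarrow> of_int D * coeff p i \<in> \<int>"
proof -
  have "\<exists>D::int. D > 0 \<and> (\<forall>p\<in>M. \<forall>i. of_int D * coeff p i \<in> \<int>)"
    using assms
  proof (induction M)
    case (insert p M)
    then obtain D :: int where D: "D > 0" "\<forall>p\<in>M. \<forall>i. of_int D * coeff p i \<in> \<int>" by auto
    define e where "e i = snd (quotient_of (coeff p i))" for i
    define E where "E = (\<Prod>i\<le>degree p. e i)"
    have pos: "e i > 0" for i unfolding e_def by (rule quotient_of_denom_pos')
    have e: "of_int (e i) * coeff p i \<in> \<int>" for i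
    proof -
      obtain u v where uv: "quotient_of (coeff p i) = (u, v)" by fastforce
      then have "coeff p i = of_int u / of_int v" "v > 0"
        using quotient_of_div quotient_of_denom_pos by blast+
      then show ?thesis using uv by (simp add: e_def)
    qed
    have E: "of_int E * coeff p i \<in> \<int>" for i
    proof (cases "i \<le> degree p")
      case True
      then have "E = (\<Prod>j\<in>{..degree p} - {i}. e j) * e i"
        by (simp add: E_def prod.remove[of _ i] mult.commute)
      then have "of_int E * coeff p i = of_int (\<Prod>j\<in>{..degree p} - {i}. e j) * (of_int (e i) * coeff p i)"
        by (simp add: mult_ac)
      also have "\<dots> \<in> \<int>" by (intro Ints_mult e Ints_of_int)
      finally show ?thesis .
    qed (simp add: coeff_eq_0)
    have "E > 0" unfolding E_def by (intro prod_pos) (auto simp: pos)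
    moreover have "of_int (D * E) * coeff q i \<in> \<int>" if "q \<in> insert p M" for q i
    proof (cases "q = p")
      case True
      have "of_int D * (of_int E * coeff p i) \<in> \<int>" by (intro Ints_mult E Ints_of_int)
      then show ?thesis using True by (simp add: mult_ac)
    next
      case False
      then have "of_int D * coeff q i \<in> \<int>" using D(2) that by blast
      then have "of_int E * (of_int D * coeff q i) \<in> \<int>" by (rule Ints_mult[OF Ints_of_int])
      then show ?thesis by (simp add: mult_ac)
    qed
    ultimately show ?case using D by (intro exI[of _ "D * E"]) auto
  qed (auto intro: exI[of _ 1])
  then show ?thesis using that by blast
qed

text \<open>Reduction modulo the minimal polynomial keeps the value at \<open>c\<close>. Only the
  finitely many generators are reduced, so one denominator \<open>D\<close> serves all their integer
  combinations.\<close>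

lemma span_values_reduced:
  fixes c :: complex
  assumes "algebraic c" "finite M"
  obtains D :: int where "D > 0"
    "\<And>z. z \<in> int_span ((\<lambda>p. poly (rpoly p) c) ` M) \<Longrightarrow>
      \<exists>r. degree r < degree (min_poly c) \<and> (\<forall>i. of_int D * coeff r i \<in> \<int>) \<and> poly (rpoly r) c = z"
proof -
  define m where "m = min_poly c"
  have m: "lead_coeff m = 1" "irreducible m" "poly (rpoly m) c = 0"
    using is_min_poly_min_poly[OF assms(1)] by (auto simp: is_min_poly_def m_def)
  have dm: "degree m > 0"
  proof (rule ccontr)
    assume "\<not> degree m > 0"
    then obtain k where "m = [:k:]" by (auto elim: degree_eq_zeroE)
    then show False using m by (simp add: rpoly_const)
  qed
  have degm: "degree (p mod m) < degree m" for p
  proof -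
    have "m \<noteq> 0" using dm by auto
    from degree_mod_less[OF this, of p] show ?thesis
    proof
      assume "p mod m = 0"
      then show ?thesis using dm by (simp only: degree_0)
    qed
  qed
  have red: "poly (rpoly (p mod m)) c = poly (rpoly p) c" for p
  proof -
    have "poly (rpoly (p div m * m + p mod m)) c = poly (rpoly (p mod m)) c"
      using m by (simp only: rpoly_hom poly_add poly_mult) simp
    then show ?thesis by simp
  qed
  obtain D :: int where D: "D > 0" "\<And>p i. p \<in> (\<lambda>p. p mod m) ` M \<Longrightarrow> of_int D * coeff p i \<in> \<int>"
    using common_denominator[of "(\<lambda>p. p mod m) ` M"] assms(2) by blast
  show ?thesis
  proof (rule that[OF D(1)], unfold m_def[symmetric])
    fix z assume "z \<in> int_span ((\<lambda>p. poly (rpoly p) c) ` M)"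
    then show "\<exists>r. degree r < degree m \<and> (\<forall>i. of_int D * coeff r i \<in> \<int>) \<and> poly (rpoly r) c = z"
    proof (induction rule: int_span.induct)
      case zero
      then show ?case using dm by (intro exI[of _ 0]) auto
    next
      case (add x s)
      then obtain r p where r: "degree r < degree m" "\<forall>i. of_int D * coeff r i \<in> \<int>" "poly (rpoly r) c = x"
        and p: "p \<in> M" "s = poly (rpoly p) c" by auto
      have "degree (p mod m) < degree m" by (rule degm)
      moreover have "of_int D * coeff (p mod m) i \<in> \<int>" for i using D(2) p by auto
      ultimately show ?case using r p
        by (intro exI[of _ "r + p mod m"]) (auto simp: degree_add_less rpoly_hom red distrib_left)
    next
      case (diff x s)
      then obtain r p where r: "degree r < degree m" "\<forall>i. of_int D * coeff r i \<in> \<int>" "poly (rpoly r) c = x"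
        and p: "p \<in> M" "s = poly (rpoly p) c" by auto
      have "degree (p mod m) < degree m" by (rule degm)
      moreover have "of_int D * coeff (p mod m) i \<in> \<int>" for i using D(2) p by auto
      ultimately show ?case using r p
        by (intro exI[of _ "r - p mod m"]) (auto simp: degree_diff_less rpoly_hom red right_diff_distrib)
    qed
  qed
qed

lemma poly_eq_if_eq_on:
  fixes p q :: "'a::idom poly"
  assumes "degree p < card A" "degree q < card A" "\<And>x. x \<in> A \<Longrightarrow> poly p x = poly q x"
  shows "p = q"
proof (rule ccontr)
  assume "p \<noteq> q"
  then have "p - q \<noteq> 0" by simp
  have "card A \<le> card {x. poly (p - q) x = 0}"
    using poly_roots_finite[OF \<open>p - q \<noteq> 0\<close>] assms(3) by (intro card_mono) auto
  also have "\<dots> \<le> degree (p - q)" by (rule card_poly_roots_bound[OF \<open>p - q \<noteq> 0\<close>])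
  also have "\<dots> < card A" using assms by (intro degree_diff_less)
  finally show False by simp
qed

text \<open>Lagrange interpolation with the basis \<open>L\<close>: the coefficients are fixed
  linear combinations of the values on \<open>A\<close>.\<close>

lemma coeffs_tendsto_0_if_values_tendsto_0:
  fixes r :: "nat \<Rightarrow> complex poly"
  assumes "finite A" "\<And>k. degree (r k) < card A"
    and lim: "\<And>x. x \<in> A \<Longrightarrow> (\<lambda>k. poly (r k) x) \<longlonglongrightarrow> 0"
  shows "(\<lambda>k. coeff (r k) i) \<longlonglongrightarrow> 0"
proof -
  define L where "L x = (\<Prod>y\<in>A - {x}. smult (inverse (x - y)) [:- y, 1:])" for x
  have L: "poly (L x) z = (if z = x then 1 else 0)" if "x \<in> A" "z \<in> A" for x z
  proof (cases "z = x")
    case True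
    have "poly (smult (inverse (x - y)) [:- y, 1:]) x = 1" if "y \<in> A - {x}" for y
    proof -
      have "inverse (x - y) * (x - y) = 1" using that by (intro left_inverse) auto
      then show ?thesis by (simp add: algebra_simps)
    qed
    then show ?thesis unfolding L_def poly_prod using True by (simp del: poly_smult)
  next
    case False
    then show ?thesis unfolding L_def poly_prod using that assms(1)
      by (auto intro!: prod_zero bexI[of _ z])
  qed
  have degL: "degree (L x) < card A" if "x \<in> A" for x
  proof -
    have "degree (L x) \<le> (\<Sum>y\<in>A - {x}. degree (smult (inverse (x - y)) [:- y, 1:]))"
      unfolding L_def using assms(1) by (intro degree_prod_sum_le[unfolded o_def]) auto
    also have "\<dots> \<le> (\<Sum>y\<in>A - {x}. 1)" by (intro sum_mono) auto
    also have "\<dots> = card A - 1" using that assms(1) by simp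
    also have "\<dots> < card A" using that assms(1) card_gt_0_iff[of A] by (intro diff_less) auto
    finally show ?thesis .
  qed
  have "r k = (\<Sum>x\<in>A. smult (poly (r k) x) (L x))" for k
  proof (rule poly_eq_if_eq_on[of _ A])
    have "0 < card A" using assms(2)[of k] by simp
    then show "degree (\<Sum>x\<in>A. smult (poly (r k) x) (L x)) < card A"
      by (intro degree_sum_less) (auto intro: le_less_trans[OF degree_smult_le] degL)
    show "poly (r k) z = poly (\<Sum>x\<in>A. smult (poly (r k) x) (L x)) z" if "z \<in> A" for z
    proof -
      have "poly (\<Sum>x\<in>A. smult (poly (r k) x) (L x)) z = (\<Sum>x\<in>A. if z = x then poly (r k) x else 0)"
        unfolding poly_sum by (intro sum.cong) (auto simp: L that)
      then show ?thesis using assms(1) that by simp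
    qed
  qed (rule assms(2))
  then have "coeff (r k) i = (\<Sum>x\<in>A. poly (r k) x * coeff (L x) i)" for k
    by (metis (no_types, lifting) coeff_smult coeff_sum sum.cong)
  moreover have "(\<lambda>k. \<Sum>x\<in>A. poly (r k) x * coeff (L x) i) \<longlonglongrightarrow> (\<Sum>x\<in>A. 0 * coeff (L x) i)"
    by (intro tendsto_intros lim)
  ultimately show ?thesis by simp
qed

text \<open>The powers \<open>F(c)\<^sup>k\<close> are values of polynomials of degree below that of \<open>c\<close> with bounded
  denominators, while all their conjugates tend to zero; hence they vanish eventually.\<close>

lemma int_orb_small_conjugates:
  assumes b: "of_int b * \<alpha> = of_int r"
    and c: "algebraic c" "preperiodic (quad_map c) (of_rat \<alpha>)"
    and F: "F \<in> int_orb \<alpha> b"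
    and small: "\<And>z::complex. poly (rpoly (min_poly c)) z = 0 \<Longrightarrow> norm (poly (rpoly F) z) < 1"
  shows "poly (rpoly F) c = 0"
proof -
  define d where "d = degree (min_poly c)"
  define A where "A = {z::complex. poly (rpoly (min_poly c)) z = 0}"
  have cA: "c \<in> A" using is_min_poly_min_poly[OF c(1)] by (simp add: A_def is_min_poly_def)
  have cardA: "card A = d" unfolding A_def d_def by (rule card_conjugates[OF c(1)])
  have finA: "finite A"
  proof -
    have "min_poly c \<noteq> 0" using is_min_poly_min_poly[OF c(1)] by (auto simp: is_min_poly_def)
    then show ?thesis unfolding A_def by (intro poly_roots_finite) (simp add: rpoly_eq_0_iff)
  qed
  obtain M where M: "finite M"
    "\<And>p. p \<in> int_orb \<alpha> b \<Longrightarrow> poly (rpoly p) c \<in> int_span ((\<lambda>p. poly (rpoly p) c) ` M)"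
    using int_orb_values_in_span[OF b c(2)] by blast
  obtain D :: int where D: "D > 0"
    "\<And>z. z \<in> int_span ((\<lambda>p. poly (rpoly p) c) ` M) \<Longrightarrow>
      \<exists>r. degree r < d \<and> (\<forall>i. of_int D * coeff r i \<in> \<int>) \<and> poly (rpoly r) c = z"
    using span_values_reduced[OF c(1) M(1)] unfolding d_def by blast
  have "\<exists>r. degree r < d \<and> (\<forall>i. of_int D * coeff r i \<in> \<int>) \<and> poly (rpoly r) c = poly (rpoly (F ^ k)) c" for k
    using D(2)[OF M(2)[OF int_orb_power[OF F]]] .
  then obtain R where R: "\<And>k. degree (R k) < d" "\<And>k i. of_int D * coeff (R k) i \<in> \<int>"
    "\<And>k. poly (rpoly (R k)) c = poly (rpoly (F ^ k)) c" by metis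
  \<comment> \<open>\<open>R k - F ^ k\<close> vanishes at \<open>c\<close>, hence at every
    conjugate.\<close>
  have conj: "poly (rpoly (R k)) z = poly (rpoly F) z ^ k" if "z \<in> A" for k z
  proof -
    have "poly (rpoly (R k - F ^ k)) c = 0" using R(3)[of k] by (simp add: rpoly_hom)
    then have "poly (rpoly (R k - F ^ k)) z = 0"
      using conjugate_root[OF c(1)] that by (simp add: A_def)
    then show ?thesis by (simp add: rpoly_hom rpoly_power)
  qed
  have lim: "(\<lambda>k. coeff (rpoly (R k) :: complex poly) i) \<longlonglongrightarrow> 0" for i
  proof (rule coeffs_tendsto_0_if_values_tendsto_0[OF finA])
    show "degree (rpoly (R k) :: complex poly) < card A" for k
      using R(1)[of k] by (simp add: cardA degree_map_poly)
    show "(\<lambda>k. poly (rpoly (R k)) z) \<longlonglongrightarrow> 0" if "z \<in> A" for z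
      using that small unfolding conj[OF that] A_def by (intro LIMSEQ_power_zero) auto
  qed
  have "\<forall>\<^sub>F k in sequentially. coeff (R k) i = 0" for i
  proof -
    have "\<forall>\<^sub>F k in sequentially. norm (coeff (rpoly (R k) :: complex poly) i) < 1 / of_int D"
      using tendstoD[OF lim[of i], of "1 / of_int D"] D(1) by simp
    then show ?thesis
    proof eventually_elim
      case (elim k)
      \<comment> \<open>\<open>D\<close> times the coefficient is an integer \<open>j\<close>, and
        by \<open>elim\<close> it is below 1 in absolute value.\<close>
      obtain j where j: "of_int D * coeff (R k) i = of_int j" using R(2)[of k i] Ints_cases by blast
      then have "complex_of_rat (of_int D * coeff (R k) i) = of_int j" by simp
      then have "of_int D * coeff (rpoly (R k) :: complex poly) i = of_int j"
        by (simp add: of_rat_mult coeff_map_poly)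
      then have "of_int D * norm (coeff (rpoly (R k) :: complex poly) i) = \<bar>of_int j\<bar>"
        using D(1) by (metis norm_mult norm_of_int abs_of_pos of_int_0_less_iff)
      moreover have "of_int D * norm (coeff (rpoly (R k) :: complex poly) i) < 1"
        using elim D(1) by (simp add: field_simps)
      ultimately have "j = 0" by linarith
      then show ?case using j D(1) by simp
    qed
  qed
  then have "\<forall>\<^sub>F k in sequentially. \<forall>i\<in>{..<d}. coeff (R k) i = 0"
    by (intro eventually_ball_finite) auto
  then obtain k where k: "\<forall>i<d. coeff (R k) i = 0"
    using eventually_happens'[OF sequentially_bot] by force
  have "R k = 0" using k R(1)[of k] by (metis leading_coeff_0_iff)
  then have "poly (rpoly F) c ^ k = 0" using conj[OF cA, of k] by simp
  then show ?thesis by simp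
qed

section \<open>Small integral polynomials and finiteness\<close>

text \<open>Descending elimination: an integer multiple of \<open>q N\<close> brings the coefficient
  at \<open>N\<close> into \<open>{0..l N}\<close>, and what remains there is taken off as a
  multiple of \<open>G N\<close>. So \<open>F\<close> approximates \<open>- H\<close> up to an error
  in a box with sides \<open>l j\<close>.\<close>

lemma combination_near_negated:
  fixes q :: "nat \<Rightarrow> rat poly" and G :: "nat \<Rightarrow> real poly" and l :: "nat \<Rightarrow> real"
  assumes G: "\<And>j. degree (G j) = j" "\<And>j. lead_coeff (G j) = 1"
    and q: "\<And>j. degree (q j) = j" "\<And>j. of_rat (lead_coeff (q j)) = l j" "\<And>j. l j > 0"
    and A: "0 \<in> A" "\<And>p k j. p \<in> A \<Longrightarrow> p + smult (of_int k) (q j) \<in> A"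
    and H: "\<forall>i\<ge>N. coeff H i = 0"
  shows "\<exists>F\<in>A. \<exists>u. (\<forall>i\<ge>N. coeff F i = 0) \<and> rpoly F + H = (\<Sum>j<N. smult (u j) (G j)) \<and>
    (\<forall>j. 0 \<le> u j \<and> u j \<le> l j)"
  using H
proof (induction N arbitrary: H)
  case 0
  then have "H = 0" by (intro poly_eqI) simp
  then show ?case using A(1) q(3) by (intro bexI[of _ 0] exI[of _ "\<lambda>_. 0"]) (auto intro: less_imp_le)
next
  case (Suc N)
  define h where "h = coeff H N"
  define x where "x = - \<lfloor>h / l N\<rfloor>"
  define v where "v = h + of_int x * l N"
  have "v = (h / l N - of_int \<lfloor>h / l N\<rfloor>) * l N"
    using q(3)[of N] by (simp add: v_def x_def left_diff_distrib)
  moreover have "0 \<le> h / l N - of_int \<lfloor>h / l N\<rfloor>" "h / l N - of_int \<lfloor>h / l N\<rfloor> \<le> 1" by linarith+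
  ultimately have v: "0 \<le> v" "v \<le> l N" using q(3)[of N] mult_right_mono[of _ 1 "l N"] by auto
  define H' where "H' = H + smult (of_int x) (rpoly (q N)) - smult v (G N)"
  have "coeff H' i = 0" if "i \<ge> N" for i
  proof (cases "i = N")
    case True
    have "coeff (G N) N = 1" "of_rat (coeff (q N) N) = l N" using G[of N] q(1,2)[of N] by simp_all
    then show ?thesis using True by (simp add: H'_def v_def h_def coeff_map_poly)
  next
    case False
    then show ?thesis using that Suc.prems G(1)[of N] q(1)[of N]
      by (simp add: H'_def coeff_map_poly coeff_eq_0)
  qed
  then obtain F u where F: "F \<in> A" "\<forall>i\<ge>N. coeff F i = 0"
    and u: "rpoly F + H' = (\<Sum>j<N. smult (u j) (G j))" "\<forall>j. 0 \<le> u j \<and> u j \<le> l j"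
    using Suc.IH[of H'] by blast
  have "rpoly (F + smult (of_int x) (q N)) + H = (\<Sum>j<Suc N. smult ((u(N := v)) j) (G j))"
  proof -
    have "rpoly (F + smult (of_int x) (q N)) + H = (rpoly F + H') + smult v (G N)"
      by (simp add: rpoly_hom H'_def)
    also have "rpoly F + H' = (\<Sum>j<N. smult ((u(N := v)) j) (G j))"
      unfolding u(1) by (intro sum.cong) auto
    finally show ?thesis by simp
  qed
  moreover have "\<forall>i\<ge>Suc N. coeff (F + smult (of_int x) (q N)) i = 0"
    using F(2) q(1)[of N] by (auto simp: coeff_eq_0)
  ultimately show ?case using A(2)[OF F(1)] u(2) v
    by (intro bexI[of _ "F + smult (of_int x) (q N)"] exI[of _ "u(N := v)"]) auto
qed

text \<open>Infinitely many combinations \<open>F\<^sub>N\<close> of degree \<open>N\<close> have coordinates \<open>0 \<le> u\<^sub>j \<le> l\<^sub>j\<close> in the basis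
  \<open>G\<^sub>j\<close>; two of them agree closely in the first \<open>J\<close> coordinates, and the others are negligible.\<close>

lemma small_integral_combination:
  fixes q :: "nat \<Rightarrow> rat poly" and G :: "nat \<Rightarrow> real poly" and l :: "nat \<Rightarrow> real"
  assumes G: "\<And>j. degree (G j) = j" "\<And>j. lead_coeff (G j) = 1"
    and q: "\<And>j. degree (q j) = j" "\<And>j. of_rat (lead_coeff (q j)) = l j" "\<And>j. l j > 0"
    and A: "0 \<in> A" "\<And>p k j. p \<in> A \<Longrightarrow> p + smult (of_int k) (q j) \<in> A"
      "\<And>p p'. p \<in> A \<Longrightarrow> p' \<in> A \<Longrightarrow> p - p' \<in> A"
    and g: "\<And>j t. t \<in> E \<Longrightarrow> \<bar>poly (G j) t\<bar> \<le> g j" "\<And>j. 0 \<le> g j" "summable (\<lambda>j. l j * g j)"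
  shows "\<exists>F\<in>A. F \<noteq> 0 \<and> (\<forall>t\<in>E. \<bar>poly (rpoly F) t\<bar> < 1)"
proof -
  have "\<exists>F\<in>A. \<exists>u. coeff F N \<noteq> 0 \<and> (\<forall>i>N. coeff F i = 0) \<and>
      (\<forall>M>N. rpoly F = (\<Sum>j<M. smult (u j) (G j))) \<and> (\<forall>j. 0 \<le> u j \<and> u j \<le> l j)" for N
  proof -
    have cN: "coeff (G N) N = 1" "of_rat (coeff (q N) N) = l N" using G[of N] q(1,2)[of N] by simp_all
    \<comment> \<open>The leading terms cancel. Adding \<open>q N\<close> back afterwards yields a
      combination of exact degree \<open>N\<close>, so different \<open>N\<close> give different
      polynomials.\<close>
    define H where "H = rpoly (q N) - smult (l N) (G N)"
    have "coeff H i = 0" if "i \<ge> N" for i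
      using that cN G(1)[of N] q(1)[of N]
      by (cases "i = N") (auto simp: H_def coeff_map_poly coeff_eq_0)
    then obtain F u where F: "F \<in> A" "\<forall>i\<ge>N. coeff F i = 0"
      and u: "rpoly F + H = (\<Sum>j<N. smult (u j) (G j))" "\<forall>j. 0 \<le> u j \<and> u j \<le> l j"
      using combination_near_negated[OF G q A(1,2), of N H] by blast
    define w where "w j = (if j < N then u j else if j = N then l N else 0)" for j
    have "rpoly (F + q N) = (\<Sum>j<M. smult (w j) (G j))" if "M > N" for M
    proof -
      have "rpoly (F + q N) = (rpoly F + H) + smult (l N) (G N)" by (simp add: rpoly_hom H_def)
      also have "\<dots> = (\<Sum>j<Suc N. smult (w j) (G j))" by (simp add: u(1) w_def)
      also have "\<dots> = (\<Sum>j<M. smult (w j) (G j))"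
        using that by (intro sum.mono_neutral_left) (auto simp: w_def)
      finally show ?thesis .
    qed
    moreover have "coeff (q N) N \<noteq> 0" using cN(2) q(3)[of N] by auto
    then have "coeff (F + q N) N \<noteq> 0" using F(2) by simp
    moreover have "\<forall>i>N. coeff (F + q N) i = 0" using F(2) q(1)[of N] by (simp add: coeff_eq_0)
    moreover have "\<forall>j. 0 \<le> w j \<and> w j \<le> l j" using u(2) q(3) by (auto simp: w_def intro: less_imp_le)
    moreover have "F + q N \<in> A" using A(2)[OF F(1), of 1 N] by simp
    ultimately show ?thesis by blast
  qed
  then obtain F u where F: "\<And>N. F N \<in> A" "\<And>N. coeff (F N) N \<noteq> 0" "\<And>N i. i > N \<Longrightarrow> coeff (F N) i = 0"
    and u: "\<And>N M. M > N \<Longrightarrow> rpoly (F N) = (\<Sum>j<M. smult (u N j) (G j))"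
      "\<And>N j. 0 \<le> u N j" "\<And>N j. u N j \<le> l j" by metis
  \<comment> \<open>Beyond \<open>J\<close> the total contribution is below 1/2; \<open>k\<close> is
    then so large that cells of width \<open>l j / k\<close> keep the first \<open>J\<close> terms
    below 1/2 as well.\<close>
  obtain J where J: "\<And>m n. J \<le> m \<Longrightarrow> \<bar>\<Sum>j=m..<n. l j * g j\<bar> < 1/2"
    using g(3)[unfolded summable_Cauchy, rule_format, of "1/2"] by auto
  obtain k :: nat where k: "2 * (\<Sum>j<J. l j * g j) < k" using reals_Archimedean2 by blast
  have "0 \<le> (\<Sum>j<J. l j * g j)" using g(2) q(3) by (intro sum_nonneg mult_nonneg_nonneg) (auto intro: less_imp_le)
  then have k0: "k > 0" using k by (cases k) auto
  \<comment> \<open>The pattern of cells that contain the first \<open>J\<close> coordinates; only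
    finitely many patterns occur, so two indices share one.\<close>
  define \<phi> where "\<phi> N = (\<lambda>j\<in>{..<J}. \<lfloor>k * (u N j / l j)\<rfloor>)" for N
  have "\<lfloor>k * (u N j / l j)\<rfloor> \<in> {0..int k}" for N j
  proof -
    have "0 \<le> u N j / l j" "u N j / l j \<le> 1" using u(2,3)[of N j] q(3)[of j] by auto
    then have "0 \<le> k * (u N j / l j)" "k * (u N j / l j) \<le> real k"
      using mult_left_mono[of "u N j / l j" 1 "real k"] mult_nonneg_nonneg[of "real k" "u N j / l j"]
      by simp_all
    then show ?thesis by (simp add: floor_le_iff)
  qed
  then have "\<phi> N \<in> {..<J} \<rightarrow>\<^sub>E {0..int k}" for N unfolding \<phi>_def restrict_PiE_iff by blast
  then have "range \<phi> \<subseteq> {..<J} \<rightarrow>\<^sub>E {0..int k}" by blast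
  then have "finite (range \<phi>)" by (rule finite_subset) (intro finite_PiE; simp)
  then have "\<not> inj \<phi>" using finite_imageD infinite_UNIV_nat by blast
  then obtain N N' where N: "N < N'" "\<phi> N = \<phi> N'"
    unfolding inj_on_def by (metis linorder_neqE_nat)
  have low: "\<bar>u N j - u N' j\<bar> \<le> l j / k" if "j < J" for j
  proof -
    have "\<lfloor>k * (u N j / l j)\<rfloor> = \<lfloor>k * (u N' j / l j)\<rfloor>"
      using fun_cong[OF N(2), of j] that by (simp add: \<phi>_def)
    then have "\<bar>k * (u N j / l j) - k * (u N' j / l j)\<bar> \<le> 1" by linarith
    moreover have "k * (u N j / l j) - k * (u N' j / l j) = (u N j - u N' j) * (k / l j)"
      by (simp add: algebra_simps diff_divide_distrib)
    ultimately have "\<bar>u N j - u N' j\<bar> * (k / l j) \<le> 1"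
      using q(3)[of j] k0 by (simp add: abs_mult)
    then show ?thesis using q(3)[of j] k0 by (simp add: field_simps)
  qed
  have high: "\<bar>u N j - u N' j\<bar> \<le> l j" for j using u(2,3)[of N j] u(2,3)[of N' j] by linarith
  define D where "D = F N - F N'"
  have "coeff D N' \<noteq> 0" using F(2)[of N'] F(3)[of N N'] N(1) by (simp add: D_def)
  then have "D \<noteq> 0" by auto
  moreover have "D \<in> A" unfolding D_def by (intro A(3) F(1))
  moreover have "\<bar>poly (rpoly D) t\<bar> < 1" if t: "t \<in> E" for t
  proof -
    define M where "M = J + Suc N'"
    have M: "M > N" "M > N'" "J \<le> M" using N(1) by (auto simp: M_def)
    have "rpoly D = (\<Sum>j<M. smult (u N j) (G j)) - (\<Sum>j<M. smult (u N' j) (G j))"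
      by (simp only: D_def rpoly_hom u(1)[OF M(1)] u(1)[OF M(2)])
    also have "\<dots> = (\<Sum>j<M. smult (u N j - u N' j) (G j))"
      by (simp add: sum_subtractf smult_diff_left)
    finally have "poly (rpoly D) t = (\<Sum>j<M. (u N j - u N' j) * poly (G j) t)"
      by (simp add: poly_sum)
    also have "\<bar>\<dots>\<bar> \<le> (\<Sum>j<M. \<bar>u N j - u N' j\<bar> * g j)"
      by (rule order.trans[OF sum_abs]) (auto simp: abs_mult intro!: sum_mono mult_left_mono g(1) t)
    also have "\<dots> = (\<Sum>j<J. \<bar>u N j - u N' j\<bar> * g j) + (\<Sum>j=J..<M. \<bar>u N j - u N' j\<bar> * g j)"
      using M(3) by (simp add: lessThan_atLeast0 sum.atLeastLessThan_concat)
    also have "(\<Sum>j<J. \<bar>u N j - u N' j\<bar> * g j) \<le> (\<Sum>j<J. l j / k * g j)"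
      using low g(2) by (intro sum_mono mult_right_mono) auto
    also have "(\<Sum>j<J. l j / k * g j) = (\<Sum>j<J. l j * g j) / k" by (simp add: sum_divide_distrib)
    also have "\<dots> < 1/2" using k k0 by (simp add: field_simps)
    also have "(\<Sum>j=J..<M. \<bar>u N j - u N' j\<bar> * g j) \<le> (\<Sum>j=J..<M. l j * g j)"
      using high g(2) by (intro sum_mono mult_right_mono) auto
    also have "\<dots> < 1/2" using J[of J M] by simp
    finally show ?thesis by simp
  qed
  ultimately show ?thesis by blast
qed

text \<open>Comparison with the geometric series of ratio \<open>root m (1/2)\<close>: replacing the
  exponent \<open>m * (j div m)\<close> by \<open>j\<close> costs at most a factor 2.\<close>

lemma summable_power_div:
  assumes "0 < m"
  shows "summable (\<lambda>j. (1/2 :: real) ^ (j div m))"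
proof -
  define r where "r = root m (1/2 :: real)"
  have r: "0 < r" "r < 1" "r ^ m = 1/2" using assms by (auto simp: r_def)
  have "(1/2 :: real) ^ (j div m) \<le> 2 * r ^ j" for j
  proof -
    have "r ^ m \<le> r ^ (j mod m)" using r assms by (intro power_decreasing) (auto intro: less_imp_le)
    then have "1 \<le> 2 * r ^ (j mod m)" using r by simp
    then have "(1/2) ^ (j div m) * 1 \<le> (1/2) ^ (j div m) * (2 * r ^ (j mod m))"
      by (intro mult_left_mono) auto
    also have "\<dots> = 2 * (r ^ m) ^ (j div m) * r ^ (j mod m)" unfolding r(3) by simp
    also have "\<dots> = 2 * r ^ j"
      by (metis div_mult_mod_eq mult.assoc mult.commute power_add power_mult)
    finally show ?thesis by simp
  qed
  moreover have "summable (\<lambda>j. 2 * r ^ j)" using r by (intro summable_mult summable_geometric) auto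
  ultimately show ?thesis
    by (intro summable_comparison_test[of "\<lambda>j. (1/2) ^ (j div m)" "\<lambda>j. 2 * r ^ j"]) auto
qed

lemma degree_lead_coeff_power_mult:
  fixes p q :: "'a::idom poly"
  assumes "p \<noteq> 0" "q \<noteq> 0"
  shows "degree (p ^ i * q ^ j) = i * degree p + j * degree q"
    and "lead_coeff (p ^ i * q ^ j) = lead_coeff p ^ i * lead_coeff q ^ j"
proof -
  show "degree (p ^ i * q ^ j) = i * degree p + j * degree q"
    using assms by (simp add: degree_mult_eq degree_power_eq)
  show "lead_coeff (p ^ i * q ^ j) = lead_coeff p ^ i * lead_coeff q ^ j"
    by (simp only: lead_coeff_mult lead_coeff_power)
qed

lemma finite_if_abs_lt_2:
  fixes \<alpha> :: rat
  assumes "\<bar>\<alpha>\<bar> < 2"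
  shows "finite {c. totally_real c \<and> preperiodic (quad_map c) (of_rat \<alpha>)}" (is "finite ?S")
proof -
  define x :: real where "x = of_rat \<alpha>"
  define a where "a = max \<bar>x\<bar> (1/2)"
  have x2: "\<bar>x\<bar> < 2"
    using assms unfolding x_def by (metis of_rat_less of_rat_numeral_eq abs_of_rat)
  define E where "E = {t. \<exists>m n. m < n \<and> poly (orb x n) t = poly (orb x m) t}"
  have E: "-8 \<le> t \<and> t \<le> a - a\<^sup>2 \<and> (\<forall>n. \<bar>poly (orb x n) t\<bar> \<le> 4)" if "t \<in> E" for t
    using real_parameter_bounds[OF x2 a_def, of t] that by (auto simp: E_def)
  have a: "\<bar>x\<bar> \<le> a" "a < 2" "1/2 \<le> a" using x2 by (auto simp: a_def)
  have "(a - 1/2)\<^sup>2 \<ge> 0" by simp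
  then have "a - a\<^sup>2 \<le> 1 / 4" by (simp add: power2_eq_square algebra_simps)
  then have E8: "\<bar>t\<bar> \<le> 8" if "t \<in> E" for t using E[OF that] by auto
  obtain r b where rb: "quotient_of \<alpha> = (r, b)" by fastforce
  then have b: "b > 0" "of_int b * \<alpha> = of_int r"
    using quotient_of_denom_pos[OF rb] quotient_of_div[OF rb] by auto
  \<comment> \<open>With this bound, \<open>b\<close> times the sup norm of \<open>G0\<close> is at
    most 1/2, which makes up for the leading coefficient \<open>b\<close> of the integral
    polynomial.\<close>
  obtain n G0 where G0: "degree G0 = 2 ^ Suc n" "lead_coeff G0 = 1"
      "\<And>t. t \<in> E \<Longrightarrow> \<bar>poly G0 t\<bar> \<le> 1 / (2 * of_int b)"
    using small_monic_poly[OF a E, of E "1 / (2 * of_int b)"] b by auto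
  define m :: nat where "m = 2 ^ Suc n"
  have m: "m > 0" by (simp add: m_def)
  \<comment> \<open>Division of \<open>j\<close> by \<open>m\<close> gives one \<open>G j\<close>
    and one \<open>q j\<close> in every degree; the exponent \<open>j mod m\<close> stays below
    \<open>m\<close>, so \<open>l j * g j\<close> decays like
    \<open>(1/2) ^ (j div m)\<close>.\<close>
  define G where "G j = G0 ^ (j div m) * [:0, 1:] ^ (j mod m)" for j
  define q where "q j = (smult (of_int b) (orb \<alpha> (Suc (Suc n)))) ^ (j div m) * (smult (of_int b) (orb \<alpha> (Suc 0))) ^ (j mod m)" for j
  define l :: "nat \<Rightarrow> real" where "l j = of_int b ^ (j div m + j mod m)" for j
  define g :: "nat \<Rightarrow> real" where "g j = (1 / (2 * of_int b)) ^ (j div m) * 8 ^ (j mod m)" for j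
  have G0': "G0 \<noteq> 0" using G0 by auto
  have orb0: "orb \<alpha> (Suc i) \<noteq> 0" for i using orb_monic[of \<alpha> i] by auto
  have "\<exists>F\<in>int_orb \<alpha> b. F \<noteq> 0 \<and> (\<forall>t\<in>E. \<bar>poly (rpoly F) t\<bar> < 1)"
  proof (rule small_integral_combination[of G q l _ E g])
    have X: "[:0, 1 :: real:] \<noteq> 0" by simp
    have "degree (G j) = j div m * m + j mod m * degree [:0, 1 :: real:]" for j
      unfolding G_def degree_lead_coeff_power_mult(1)[OF G0' X] G0(1) m_def ..
    then show "degree (G j) = j" for j by simp
    show "lead_coeff (G j) = 1" for j
      unfolding G_def degree_lead_coeff_power_mult(2)[OF G0' X] G0(2) by simp
    have B: "smult (of_int b) (orb \<alpha> (Suc i)) \<noteq> 0" for i using b orb0[of i] by (simp del: orb.simps)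
    have "degree (q j) = j div m * m + j mod m * 1" for j
      unfolding q_def degree_lead_coeff_power_mult(1)[OF B B] using b
      by (simp add: orb_monic m_def del: orb.simps)
    then show "degree (q j) = j" for j by simp
    have lb: "lead_coeff (smult (of_int b) (orb \<alpha> (Suc i))) = of_int b" for i
      unfolding lead_coeff_smult orb_monic(2) by simp
    show "of_rat (lead_coeff (q j)) = l j" for j
      unfolding q_def l_def degree_lead_coeff_power_mult(2)[OF B B] lb
      by (simp add: of_rat_mult of_rat_power power_add)
    show "l j > 0" for j using b by (simp add: l_def)
    have q_int: "q j \<in> int_orb \<alpha> b" for j
      unfolding q_def by (intro int_orb.mult int_orb_power int_orb.orb)
    show "0 \<in> int_orb \<alpha> b" using int_orb.const[of 0 \<alpha> b] by simp
    show "p + smult (of_int k) (q j) \<in> int_orb \<alpha> b" if "p \<in> int_orb \<alpha> b" for p k j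
      using that by (intro int_orb.add int_orb_smult_of_int q_int)
    show "p - p' \<in> int_orb \<alpha> b" if "p \<in> int_orb \<alpha> b" "p' \<in> int_orb \<alpha> b" for p p'
      using that by (rule int_orb_diff)
    show "\<bar>poly (G j) t\<bar> \<le> g j" if "t \<in> E" for j t
      unfolding G_def g_def using G0(3)[OF that] E8[OF that] b
      by (simp add: poly_power abs_mult power_abs mult_mono power_mono del: power_divide)
    show "0 \<le> g j" for j using b by (simp add: g_def)
    have "l j * g j \<le> (8 * of_int b) ^ m * (1/2) ^ (j div m)" for j
    proof -
      have "l j * g j = (8 * of_int b) ^ (j mod m) * (of_int b * (1 / (2 * of_int b))) ^ (j div m)"
        by (simp only: l_def g_def power_add power_mult_distrib mult_ac)
      also have "of_int b * (1 / (2 * of_int b)) = (1/2 :: real)" using b by simp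
      also have "(8 * of_int b) ^ (j mod m) * (1/2 :: real) ^ (j div m) \<le> (8 * of_int b) ^ m * (1/2) ^ (j div m)"
        using b m by (intro mult_right_mono power_increasing) (auto intro: less_imp_le)
      finally show ?thesis .
    qed
    moreover have "summable (\<lambda>j. (8 * real_of_int b) ^ m * (1/2) ^ (j div m))"
      by (intro summable_mult summable_power_div m)
    moreover have "0 \<le> l j * g j" for j using b by (simp add: l_def g_def)
    ultimately show "summable (\<lambda>j. l j * g j)"
      by (intro summable_comparison_test[of "\<lambda>j. l j * g j" "\<lambda>j. (8 * of_int b) ^ m * (1/2) ^ (j div m)"]) auto
  qed
  then obtain F where F: "F \<in> int_orb \<alpha> b" "F \<noteq> 0" "\<And>t. t \<in> E \<Longrightarrow> \<bar>poly (rpoly F) t\<bar> < 1" by blast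
  have "?S \<subseteq> {c. poly (rpoly F) c = 0}"
  proof
    fix c assume "c \<in> ?S"
    then have c: "algebraic c" "preperiodic (quad_map c) (of_rat \<alpha>)"
      and real: "\<And>z::complex. poly (rpoly (min_poly c)) z = 0 \<Longrightarrow> z \<in> \<real>"
      by (auto simp: totally_real_def)
    obtain i j where ij: "i < j" "poly (orb (of_rat \<alpha>) j) c = poly (orb (of_rat \<alpha>) i) c"
      using c(2) by (auto simp: preperiodic_iff_orb)
    have "poly (rpoly F) c = 0"
    proof (rule int_orb_small_conjugates[OF b(2) c F(1)])
      fix z :: complex assume z: "poly (rpoly (min_poly c)) z = 0"
      then obtain t where t: "z = of_real t" using real by (auto elim: Reals_cases)
      \<comment> \<open>All conjugates of \<open>c\<close> are real and satisfy the same orbit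
        relation, so they lie in \<open>E\<close>, where \<open>F\<close> is below 1 in absolute
        value.\<close>
      have "poly (rpoly (orb \<alpha> j - orb \<alpha> i)) c = 0" by (simp add: rpoly_hom rpoly_orb ij)
      then have "poly (rpoly (orb \<alpha> j - orb \<alpha> i)) z = 0" by (rule conjugate_root[OF c(1) _ z])
      then have "poly (rpoly (orb \<alpha> j - orb \<alpha> i)) t = 0" unfolding t poly_rpoly_of_real by simp
      then have "t \<in> E" using ij(1) by (auto simp: E_def rpoly_hom rpoly_orb x_def)
      then show "norm (poly (rpoly F) z) < 1" using F(3) by (simp add: t poly_rpoly_of_real)
    qed
    then show "c \<in> {c. poly (rpoly F) c = 0}" by simp
  qed
  moreover have "finite {c :: complex. poly (rpoly F) c = 0}"
    using F(2) by (intro poly_roots_finite) (simp add: rpoly_eq_0_iff)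
  ultimately show ?thesis by (rule finite_subset)
qed

text \<open>This parameter makes \<open>\<alpha>\<close> a fixed point; being rational, it is its
  only conjugate.\<close>

lemma fixed_parameter:
  fixes \<alpha> :: rat
  shows "of_rat (\<alpha> - \<alpha>\<^sup>2) \<in> {c. totally_real c \<and> preperiodic (quad_map c) (of_rat \<alpha>)}"
proof -
  define c where "c = \<alpha> - \<alpha>\<^sup>2"
  have q: "rpoly [:- c, 1:] = [:- of_rat c, 1 :: complex:]"
    by (simp add: map_poly_pCons of_rat_minus)
  have "totally_real (of_rat c)"
  proof (rule totally_real_if_all_roots_real[of "[:- c, 1:]"])
    fix z :: complex assume "poly (rpoly [:- c, 1:]) z = 0"
    then have "z = of_rat c" unfolding q by simp
    then show "z \<in> \<real>" by (metis of_rat_eq_of_real Reals_of_real)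
  qed (simp_all add: q)
  moreover have "quad_map (of_rat c) (of_rat \<alpha>) = of_rat \<alpha>"
    by (simp add: quad_map_def c_def of_rat_diff of_rat_power)
  then have "preperiodic (quad_map (of_rat c)) (of_rat \<alpha>)"
    unfolding preperiodic_def by (intro exI[of _ 0] exI[of _ 1]) simp
  ultimately show ?thesis by (simp add: c_def)
qed

theorem theorem1p4:
  fixes \<alpha> :: rat
  shows "(\<bar>\<alpha>\<bar> < 2 \<longrightarrow>
            finite {c. totally_real c \<and> preperiodic (quad_map c) (of_rat \<alpha>)} \<and>
            {c. totally_real c \<and> preperiodic (quad_map c) (of_rat \<alpha>)} \<noteq> {}) \<and>
         (\<bar>\<alpha>\<bar> \<ge> 2 \<longrightarrow>
            infinite {c. totally_real c \<and> preperiodic (quad_map c) (of_rat \<alpha>)})"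
  using finite_if_abs_lt_2[of \<alpha>] infinite_if_abs_ge_2[of \<alpha>] fixed_parameter[of \<alpha>] by blast

end
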